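(* Let $G>0$, $\rho>0$ and $\omega$ be real constants, let $z_0,z_1$ be real numbers with $-z_0<z_1$, and let $f:[-z_0,z_1]\to[0,\infty)$ be a (measurable) function. Let $$B=\{(s',\phi',z')\ \text{in cylindrical coordinates}:\ -z_0\le z'\le z_1,\ 0\le s'\le f(z'),\ 0\le\phi'\le 2\pi\}\subset\mathbb{R}^3$$ be the solid of revolution generated by revolving the graph of $f$ about the $z$-axis, with constant mass density $\rho$ and center of mass at the origin, and suppose $B$ rotates with constant rotational speed $\omega$ around the $s$-axis, i.e. the line through the origin, perpendicular to the $z$-axis, in the direction $\phi=0$. For every $z\in[-z_0,z_1]$ and $\phi\in[0,2\pi]$, the total energy $U=U_{\rm G}+U_{\rm Rot}$ of a particle of unit mass at the surface point with cylindrical coordinates $(f(z),\phi,z)$ is $$U=-2\pi G\rho\int_{-z_0}^{z_1} f(z')\,\mathbf{Y}\big(f(z'),f(z),|z-z'|\big)\,dz'-\frac12\,\omega^2\big(f^2(z)\sin^2(\phi)+z^2\big),$$ where $U_{\rm G}$, $U_{\rm Rot}$ and $\mathbf{Y}$ are as defined in the context.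
   Context: Cylindrical coordinates $(s,\phi,z)$ in $\mathbb{R}^3$: $s\ge0$ is the distance to the $z$-axis, $\phi$ the azimuthal angle, $z$ the axial coordinate. The gravitational potential of the body $B$ at a point $\vec r$ is $U_{\rm G}(\vec r)=-G\int_B\frac{\rho\,d^3\vec r\,'}{|\vec r-\vec r\,'|}$. The rotational energy of a particle of unit mass at a point $\vec r$ is $U_{\rm Rot}(\vec r)=-\frac12\omega^2\,\delta(\vec r)^2$, where $\delta(\vec r)$ is the distance from $\vec r$ to the rotation axis (the negative sign is the paper's convention, reflecting the repulsive centrifugal force). The total energy is $U=U_{\rm G}+U_{\rm Rot}$. Complete elliptic integrals (argument $\kappa$ is the modulus): $$\mathbf{K}(\kappa)=\int_0^1\frac{dt}{\sqrt{1-t^2}\sqrt{1-\kappa^2t^2}},\qquad \mathbf{E}(\kappa)=\int_0^1\frac{\sqrt{1-\kappa^2t^2}}{\sqrt{1-t^2}}\,dt,$$ $$\mathbf{\Pi}(\nu,\kappa)=\int_0^1\frac{dt}{(1-\nu t^2)\sqrt{1-t^2}\sqrt{1-\kappa^2t^2}}.$$ For $a>0$, $b\ge0$, $d\ge0$, put $R=\sqrt{d^2+(a+b)^2}$, $\kappa=\dfrac{2\sqrt{ab}}{R}$, $\nu=\dfrac{4ab}{(a+b)^2}$, and define $$\mathbf{Y}(a,b,d)=\frac{R}{\pi a}\mathbf{E}(\kappa)+\frac{a^2-b^2}{\pi a R}\mathbf{K}(\kappa)+\frac{d^2(a-b)}{\pi a(a+b)R}\mathbf{\Pi}(\nu,\kappa)-\frac{d}{a}\mathbf{\Theta}(a-b),$$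 where $\mathbf{\Theta}$ is the unit step function: $\mathbf{\Theta}(x)=1$ for $x>0$, $\mathbf{\Theta}(x)=0$ for $x<0$, $\mathbf{\Theta}(0)=\tfrac12$. When $a=b$ the terms containing $\mathbf{K}$ and $\mathbf{\Pi}$ (which carry the factor $a-b=0$) are taken to be $0$. The product $a\,\mathbf{Y}(a,b,d)$ is taken to be $0$ when $a=0$. (This $\mathbf{Y}(a,b,d)$ is the closed form of $\int_0^{\infty}\frac{J_1(ka)J_0(kb)}{k}e^{-kd}\,dk$, with $J_0,J_1$ Bessel functions of the first kind.) *)

theory Defs
  imports "HOL-Analysis.Analysis"
begin

definition cylindrical :: "real \<Rightarrow> real \<Rightarrow> real \<Rightarrow> real ^ 3" where
  "cylindrical s \<phi> z = vector [s * cos \<phi>, s * sin \<phi>, z]"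

definition solid_of_revolution :: "(real \<Rightarrow> real) \<Rightarrow> real \<Rightarrow> real \<Rightarrow> (real ^ 3) set" where
  "solid_of_revolution f l u =
     {cylindrical s \<phi> z | s \<phi> z. l \<le> z \<and> z \<le> u \<and> 0 \<le> s \<and> s \<le> f z \<and> 0 \<le> \<phi> \<and> \<phi> \<le> 2 * pi}"

text \<open>The line through the origin, perpendicular to the \<open>z\<close>-axis, in the direction \<open>\<phi> = 0\<close>.\<close>

definition s_axis :: "(real ^ 3) set" where
  "s_axis = range (\<lambda>t. t *\<^sub>R cylindrical 1 0 0)"

text \<open>
  The centre of mass exists only if the mass and the first moment are finite; both are required
  explicitly because a divergent integral would otherwise have the value 0. The defining equation
  \<open>c = (\<integral> \<rho> r) / (\<integral> \<rho>)\<close> is stated without division, so that a body of mass 0 is not excluded.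
\<close>

definition has_center_of_mass :: "real \<Rightarrow> (real ^ 3) set \<Rightarrow> real ^ 3 \<Rightarrow> bool" where
  "has_center_of_mass \<rho> B c \<longleftrightarrow>
     set_integrable lebesgue B (\<lambda>r. \<rho>) \<and>
     set_integrable lebesgue B (\<lambda>r. \<rho> *\<^sub>R r) \<and>
     (LINT r:B|lebesgue. \<rho>) *\<^sub>R c = (LINT r:B|lebesgue. \<rho> *\<^sub>R r)"

definition grav_potential :: "real \<Rightarrow> real \<Rightarrow> (real ^ 3) set \<Rightarrow> real ^ 3 \<Rightarrow> real" where
  "grav_potential G \<rho> B r = - G * (LINT r':B|lebesgue. \<rho> / norm (r - r'))"

definition rot_energy :: "real \<Rightarrow> (real ^ 3) set \<Rightarrow> real ^ 3 \<Rightarrow> real" where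
  "rot_energy \<omega> L r = - (1 / 2) * \<omega>\<^sup>2 * (infdist r L)\<^sup>2"

definition total_energy ::
  "real \<Rightarrow> real \<Rightarrow> real \<Rightarrow> (real ^ 3) set \<Rightarrow> (real ^ 3) set \<Rightarrow> real ^ 3 \<Rightarrow> real" where
  "total_energy G \<rho> \<omega> B L r = grav_potential G \<rho> B r + rot_energy \<omega> L r"

text \<open>Complete elliptic integrals; the argument \<open>\<kappa>\<close> is the modulus.\<close>

definition elliptic_K :: "real \<Rightarrow> real" where
  "elliptic_K \<kappa> = (LBINT t:{0..1}. 1 / (sqrt (1 - t\<^sup>2) * sqrt (1 - \<kappa>\<^sup>2 * t\<^sup>2)))"

definition elliptic_E :: "real \<Rightarrow> real" where
  "elliptic_E \<kappa> = (LBINT t:{0..1}. sqrt (1 - \<kappa>\<^sup>2 * t\<^sup>2) / sqrt (1 - t\<^sup>2))"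

definition elliptic_Pi :: "real \<Rightarrow> real \<Rightarrow> real" where
  "elliptic_Pi \<nu> \<kappa> =
     (LBINT t:{0..1}. 1 / ((1 - \<nu> * t\<^sup>2) * sqrt (1 - t\<^sup>2) * sqrt (1 - \<kappa>\<^sup>2 * t\<^sup>2)))"

definition unit_step :: "real \<Rightarrow> real" where
  "unit_step x = (if x > 0 then 1 else if x < 0 then 0 else 1 / 2)"

text \<open>
  Closed form of the integral of \<open>J\<^sub>1 (k a) J\<^sub>0 (k b) exp (- k d) / k\<close> over \<open>k > 0\<close>, for
  \<open>a > 0\<close>, \<open>b \<ge> 0\<close>, \<open>d \<ge> 0\<close>. For \<open>a = b\<close> the terms with \<open>elliptic_K\<close> and \<open>elliptic_Pi\<close>, whose
  integrals may diverge, are set to 0 by convention.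
\<close>

definition Y :: "real \<Rightarrow> real \<Rightarrow> real \<Rightarrow> real" where
  "Y a b d =
     (let R = sqrt (d\<^sup>2 + (a + b)\<^sup>2);
          \<kappa> = 2 * sqrt (a * b) / R;
          \<nu> = 4 * a * b / (a + b)\<^sup>2
      in R / (pi * a) * elliptic_E \<kappa>
         + (if a = b then 0
            else (a\<^sup>2 - b\<^sup>2) / (pi * a * R) * elliptic_K \<kappa>
                 + d\<^sup>2 * (a - b) / (pi * a * (a + b) * R) * elliptic_Pi \<nu> \<kappa>)
         - d / a * unit_step (a - b))"

end

theory Submission
  imports Defs
begin

text \<open>
  Slicing the body perpendicularly to the \<open>z\<close>-axis reduces the claim to the potential of a uniform
  disk of radius \<open>a\<close> at a point with distance \<open>b\<close> from its axis and height \<open>d > 0\<close>. For the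
  planar vector \<open>r\<close> from the projection of that point, the field \<open>r / (\<surd>(d\<^sup>2 + |r|\<^sup>2) + d)\<close> is
  smooth everywhere and has divergence \<open>1 / \<surd>(d\<^sup>2 + |r|\<^sup>2)\<close>. By Green's theorem the disk potential is
  the flux of this field through the boundary circle. With \<open>S = \<surd>(d\<^sup>2 + |r|\<^sup>2)\<close>, the identity
  \<open>1 / (S + d) = (S - d) / |r|\<^sup>2\<close> splits the flux into the three elliptic integrals and a
  Poisson-kernel integral, which yields the step function. All integrands are nonnegative,
  so Tonelli's theorem applies without integrability considerations.
\<close>

section \<open>Elliptic integrals\<close>

text \<open>Substitute \<open>t = sin \<alpha>\<close>: the weight cancels the factor
  \<open>cos \<alpha>\<close>. Since the weight is unbounded near \<open>t = 1\<close>, the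
  substitution is made for nonnegative integrals, which require no integrability; this is where
  \<open>h\<close> must be nonnegative.\<close>

lemma LBINT_arcsine_weight:
  fixes h :: "real \<Rightarrow> real"
  assumes h: "continuous_on {0..1} h" and nonneg: "\<And>t. t \<in> {0..1} \<Longrightarrow> 0 \<le> h t"
  shows "(LBINT t:{0..1}. h t / sqrt (1 - t\<^sup>2)) = integral {0..pi/2} (\<lambda>\<alpha>. h (sin \<alpha>))"
proof -
  let ?f = "\<lambda>t. h t / sqrt (1 - t\<^sup>2)"
  have sin01: "sin x \<in> {0..1}" if "x \<in> {0..pi/2}" for x
    using that by (auto intro: sin_ge_zero)
  have contc: "continuous_on {0..pi/2} (\<lambda>\<alpha>. h (sin \<alpha>))"
    by (rule continuous_on_compose2[OF h]) (use sin01 in \<open>auto intro!: continuous_intros\<close>)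
  have hm: "(\<lambda>t. indicator {0..1} t *\<^sub>R h t) \<in> borel_measurable borel"
    by (intro borel_measurable_continuous_on_indicator h) auto
  have "(\<lambda>t. (indicator {0..1} t *\<^sub>R h t) / sqrt (1 - t\<^sup>2)) \<in> borel_measurable borel"
    using hm by measurable
  then have meas: "(\<lambda>t. indicator {0..1} t *\<^sub>R ?f t) \<in> borel_measurable borel"
    by simp
  have "(\<integral>\<^sup>+x. ennreal (?f x) * indicator {sin 0..sin (pi/2)} x \<partial>lborel) =
        (\<integral>\<^sup>+x. ennreal (?f (sin x) * cos x) * indicator {0..pi/2} x \<partial>lborel)"
  proof -
    have "(\<integral>\<^sup>+x. ennreal (?f x * indicator {sin 0..sin (pi/2)} x) \<partial>lborel) =
        (\<integral>\<^sup>+x. ennreal (?f (sin x) * cos x * indicator {0..pi/2} x) \<partial>lborel)"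
      by (rule nn_integral_substitution)
        (use meas in \<open>auto simp: set_borel_measurable_def intro!: continuous_intros derivative_eq_intros cos_ge_zero\<close>)
    then show ?thesis
      by (simp add: nn_integral_set_ennreal)
  qed
  also have "\<dots> = (\<integral>\<^sup>+x. ennreal (h (sin x)) * indicator {0..pi/2} x \<partial>lborel)"
  proof (rule nn_integral_cong_AE)
    \<comment> \<open>At \<open>pi/2\<close> the left side is 0, because division by 0 gives 0,
      while the right side is \<open>h 1\<close>. The integrands therefore agree only almost
      everywhere.\<close>
    have eq: "?f (sin x) * cos x = h (sin x)" if "x \<in> {0..pi/2}" "x \<noteq> pi/2" for x
    proof -
      have "cos x > 0" using that by (intro cos_gt_zero_pi) auto
      then show ?thesis by (simp add: cos_squared_eq[symmetric])
    qed
    show "AE x in lborel. ennreal (?f (sin x) * cos x) * indicator {0..pi/2} x = ennreal (h (sin x)) * indicator {0..pi/2} x"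
      using AE_lborel_singleton[of "pi/2"]
    proof eventually_elim
      case (elim x)
      then show ?case by (cases "x \<in> {0..pi/2}") (simp_all only: elim eq not_False_eq_True indicator_simps mult_zero_right)
    qed
  qed
  finally have "(\<integral>\<^sup>+x. ennreal (?f x) * indicator {sin 0..sin (pi/2)} x \<partial>lborel) =
                (\<integral>\<^sup>+x. ennreal (h (sin x)) * indicator {0..pi/2} x \<partial>lborel)" .
  from this[unfolded nn_integral_set_ennreal sin_zero sin_pi_half]
  have nn: "(\<integral>\<^sup>+x. ennreal (indicator {0..1} x *\<^sub>R ?f x) \<partial>lborel) =
                (\<integral>\<^sup>+x. ennreal (indicator {0..pi/2} x *\<^sub>R h (sin x)) \<partial>lborel)"
    by (simp only: real_scaleR_def mult.commute)
  have "(LBINT t:{0..1}. ?f t) = enn2real (\<integral>\<^sup>+x. ennreal (indicator {0..1} x *\<^sub>R ?f x) \<partial>lborel)"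
    unfolding set_lebesgue_integral_def
  proof (rule integral_eq_nn_integral)
    show "AE x in lborel. 0 \<le> indicat_real {0..1} x *\<^sub>R ?f x"
      by (intro AE_I2) (auto split: split_indicator intro!: divide_nonneg_nonneg nonneg simp: power_le_one)
  qed (use meas in simp)
  also have "\<dots> = (LBINT x:{0..pi/2}. h (sin x))"
    unfolding nn set_lebesgue_integral_def
  proof (rule integral_eq_nn_integral[symmetric])
    show "AE x in lborel. 0 \<le> indicat_real {0..pi/2} x *\<^sub>R h (sin x)"
      using sin01 nonneg by (intro AE_I2) (auto split: split_indicator)
    show "(\<lambda>x. indicat_real {0..pi / 2} x *\<^sub>R h (sin x)) \<in> borel_measurable lborel"
    proof -
      have "(\<lambda>x. indicat_real {0..pi / 2} x *\<^sub>R h (sin x)) \<in> borel_measurable borel"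
        by (intro borel_measurable_continuous_on_indicator contc) auto
      then show ?thesis by simp
    qed
  qed
  also have "\<dots> = integral {0..pi/2} (\<lambda>\<alpha>. h (sin \<alpha>))"
    by (intro set_borel_integral_eq_integral borel_integrable_atLeastAtMost' contc)
  finally show ?thesis .
qed

text \<open>With \<open>A = a + b\<close> and \<open>B = \<bar>a - b\<bar>\<close> this is the
  Poisson-kernel integral in half-angle form. The antiderivative is obtained by writing the
  arctangent as \<open>\<alpha>\<close> plus a difference of angles, and the tangent subtraction
  formula turns that difference into the quotient in \<open>?F\<close>.\<close>

lemma has_integral_inverse_quadratic_trig:
  fixes A B :: real
  assumes "A > 0" "B > 0"
  shows "((\<lambda>\<alpha>. 1 / (A\<^sup>2 * (cos \<alpha>)\<^sup>2 + B\<^sup>2 * (sin \<alpha>)\<^sup>2)) has_integral pi / (2 * A * B)) {0..pi/2}"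
proof -
  \<comment> \<open>\<open>arctan (B * tan \<alpha> / A) / (A * B)\<close>, rewritten so as to be smooth at \<open>\<alpha> = pi/2\<close>\<close>
  let ?F = "\<lambda>\<alpha>. (\<alpha> + arctan ((B - A) * sin \<alpha> * cos \<alpha> / (A * (cos \<alpha>)\<^sup>2 + B * (sin \<alpha>)\<^sup>2))) / (A * B)"
  have D: "(?F has_real_derivative 1 / (A\<^sup>2 * (cos x)\<^sup>2 + B\<^sup>2 * (sin x)\<^sup>2)) (at x)" for x
  proof -
    define s c where "s = sin x" and "c = cos x"
    have sc: "s\<^sup>2 = 1 - c\<^sup>2" by (simp add: s_def c_def sin_squared_eq)
    have pos: "A * c\<^sup>2 + B * s\<^sup>2 > 0"
    proof (cases "c = 0")
      case True then show ?thesis using assms sc by simp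
    next
      case False then show ?thesis using assms by (intro add_pos_nonneg) auto
    qed
    have pos2: "A\<^sup>2 * c\<^sup>2 + B\<^sup>2 * s\<^sup>2 > 0"
    proof (cases "c = 0")
      case True then show ?thesis using assms sc by simp
    next
      case False then show ?thesis using assms by (intro add_pos_nonneg) auto
    qed
    let ?q = "A * c\<^sup>2 + B * s\<^sup>2"
    \<comment> \<open>The two squared terms are the real and imaginary parts of
      \<open>(A * c + i * B * s) * (c - i * s)\<close>, so their sum is the product of the squared
      moduli.\<close>
    have key1: "?q\<^sup>2 + ((B - A) * s * c)\<^sup>2 = A\<^sup>2 * c\<^sup>2 + B\<^sup>2 * s\<^sup>2"
    proof -
      have "?q\<^sup>2 + ((B - A) * s * c)\<^sup>2 = (A\<^sup>2 * c\<^sup>2 + B\<^sup>2 * s\<^sup>2) * (s\<^sup>2 + c\<^sup>2)" by algebra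
      then show ?thesis using sc by simp
    qed
    \<comment> \<open>By \<open>key1\<close> the arctangent has derivative
      \<open>n / (A\<^sup>2 * c\<^sup>2 + B\<^sup>2 * s\<^sup>2)\<close>, with \<open>n\<close> the
      first summand here. Adding the derivative 1 of \<open>\<alpha>\<close> leaves the numerator
      \<open>A * B\<close>, which the prefactor of \<open>?F\<close> cancels.\<close>
    have key2: "(B - A) * ((c\<^sup>2 - s\<^sup>2) * ?q - s * c * (2 * (B - A) * s * c)) + (A\<^sup>2 * c\<^sup>2 + B\<^sup>2 * s\<^sup>2) = A * B"
      using sc by algebra
    have "(?F has_real_derivative (1 + inverse (1 + ((B - A) * s * c / ?q)\<^sup>2) *
       ((((B - A) * (c\<^sup>2 - s\<^sup>2)) * ?q - ((B - A) * s * c) * (2 * (B - A) * s * c)) / (?q * ?q))) / (A * B)) (at x)"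
    proof -
      have Dn: "((\<lambda>\<alpha>. (B - A) * sin \<alpha> * cos \<alpha>) has_real_derivative (B - A) * (c\<^sup>2 - s\<^sup>2)) (at x)"
        by (auto simp: s_def c_def algebra_simps power2_eq_square intro!: derivative_eq_intros)
      have Dq: "((\<lambda>\<alpha>. A * (cos \<alpha>)\<^sup>2 + B * (sin \<alpha>)\<^sup>2) has_real_derivative 2 * (B - A) * s * c) (at x)"
        by (auto simp: s_def c_def algebra_simps power2_eq_square intro!: derivative_eq_intros)
      have "((\<lambda>\<alpha>. (B - A) * sin \<alpha> * cos \<alpha> / (A * (cos \<alpha>)\<^sup>2 + B * (sin \<alpha>)\<^sup>2)) has_real_derivative
        (((B - A) * (c\<^sup>2 - s\<^sup>2)) * ?q - ((B - A) * s * c) * (2 * (B - A) * s * c)) / (?q * ?q)) (at x)"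
        using DERIV_divide[OF Dn Dq] pos by (simp add: s_def c_def)
      from DERIV_chain2[OF DERIV_arctan this]
      show ?thesis
        by (intro DERIV_cdivide DERIV_add DERIV_ident) (simp_all add: s_def c_def)
    qed
    also have "(1 + inverse (1 + ((B - A) * s * c / ?q)\<^sup>2) *
       ((((B - A) * (c\<^sup>2 - s\<^sup>2)) * ?q - ((B - A) * s * c) * (2 * (B - A) * s * c)) / (?q * ?q))) / (A * B)
       = 1 / (A\<^sup>2 * c\<^sup>2 + B\<^sup>2 * s\<^sup>2)"
    proof -
      have "1 + ((B - A) * s * c / ?q)\<^sup>2 = (A\<^sup>2 * c\<^sup>2 + B\<^sup>2 * s\<^sup>2) / ?q\<^sup>2"
        using key1 pos by (simp add: field_simps)
      then have i1: "inverse (1 + ((B - A) * s * c / ?q)\<^sup>2) = ?q\<^sup>2 / (A\<^sup>2 * c\<^sup>2 + B\<^sup>2 * s\<^sup>2)"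
        by simp
      have n1: "((B - A) * (c\<^sup>2 - s\<^sup>2)) * ?q - ((B - A) * s * c) * (2 * (B - A) * s * c)
        = (B - A) * ((c\<^sup>2 - s\<^sup>2) * ?q - s * c * (2 * (B - A) * s * c))"
        by (simp add: algebra_simps)
      have gen: "?q\<^sup>2 / D * (n / (?q * ?q)) = n / D" for n D :: real
        using pos by (simp add: power2_eq_square)
      have "inverse (1 + ((B - A) * s * c / ?q)\<^sup>2) *
       ((((B - A) * (c\<^sup>2 - s\<^sup>2)) * ?q - ((B - A) * s * c) * (2 * (B - A) * s * c)) / (?q * ?q))
        = ((B - A) * ((c\<^sup>2 - s\<^sup>2) * ?q - s * c * (2 * (B - A) * s * c))) / (A\<^sup>2 * c\<^sup>2 + B\<^sup>2 * s\<^sup>2)"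
        unfolding i1 n1 by (rule gen)
      also have "1 + \<dots> = A * B / (A\<^sup>2 * c\<^sup>2 + B\<^sup>2 * s\<^sup>2)"
        using key2 pos2 by (simp add: add_divide_eq_iff add_divide_distrib[symmetric] divide_add_eq_iff add.commute)
      finally show ?thesis using assms by simp
    qed
    finally show ?thesis by (simp add: s_def c_def)
  qed
  have "((\<lambda>\<alpha>. 1 / (A\<^sup>2 * (cos \<alpha>)\<^sup>2 + B\<^sup>2 * (sin \<alpha>)\<^sup>2)) has_integral ?F (pi/2) - ?F 0) {0..pi/2}"
    by (rule fundamental_theorem_of_calculus)
      (auto simp: has_real_derivative_iff_has_vector_derivative[symmetric] intro!: has_field_derivative_at_within D)
  then show ?thesis by (simp add: mult.assoc)
qed

section \<open>The boundary integral in closed form\<close>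

text \<open>For \<open>\<theta> = pi - 2 * x\<close> one has
  \<open>cos \<theta> = 2 * (sin x)\<^sup>2 - 1\<close>. The squared distance given by the law of
  cosines thus takes the shape that fits the modulus and the parameter of the elliptic
  integrals.\<close>

lemma law_of_cosines_half_angle: "a\<^sup>2 + b\<^sup>2 - 2 * a * b * (2 * (sin x)\<^sup>2 - 1) = (a + b)\<^sup>2 - 4 * a * b * (sin x :: real)\<^sup>2"
  by (simp add: power2_eq_square algebra_simps)

text \<open>Let \<open>S\<close> be the distance to the boundary point and \<open>q\<close> the
  square of its planar part, so that \<open>S\<^sup>2 = d\<^sup>2 + q\<close>. By the law of cosines
  the numerator is \<open>(q + a\<^sup>2 - b\<^sup>2) / 2\<close>, and
  \<open>1 / (S + d) = (S - d) / q\<close> where \<open>q\<close> is nonzero. Expanding with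
  \<open>S / q = 1 / S + d\<^sup>2 / (q * S)\<close> leaves the integrands \<open>S\<close>,
  \<open>1 / S\<close> and \<open>1 / (q * S)\<close> of the three elliptic integrals, a constant,
  and the Poisson kernel \<open>1 / q\<close>.\<close>

lemma boundary_integral_eq_Y:
  fixes a b d :: real
  assumes a: "a > 0" and b: "b \<ge> 0" and d: "d > 0"
  shows "((\<lambda>\<alpha>. a * (a - b * (2 * (sin \<alpha>)\<^sup>2 - 1)) / (sqrt (d\<^sup>2 + (a + b)\<^sup>2 - 4 * a * b * (sin \<alpha>)\<^sup>2) + d))
    has_integral (pi * a * Y a b d / 2)) {0..pi/2}"
proof -
  define R where "R = sqrt (d\<^sup>2 + (a + b)\<^sup>2)"
  define \<kappa> where "\<kappa> = 2 * sqrt (a * b) / R"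
  define \<nu> where "\<nu> = 4 * a * b / (a + b)\<^sup>2"
  define S where "S = (\<lambda>\<alpha>. sqrt (d\<^sup>2 + (a + b)\<^sup>2 - 4 * a * b * (sin \<alpha>)\<^sup>2))"
  define q where "q = (\<lambda>\<alpha>. (a + b)\<^sup>2 - 4 * a * b * (sin \<alpha>)\<^sup>2)"
  have R2: "R\<^sup>2 = d\<^sup>2 + (a + b)\<^sup>2" and Rpos: "R > 0"
    using d by (simp_all add: R_def add_pos_nonneg)
  have \<kappa>2: "\<kappa>\<^sup>2 = 4 * a * b / R\<^sup>2"
    using a b by (simp add: \<kappa>_def power_divide power_mult_distrib)
  have ab4: "4 * a * b \<le> (a + b)\<^sup>2"
    using zero_le_power2[of "a - b"] by (simp add: power2_eq_square algebra_simps)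
  \<comment> \<open>Since \<open>d > 0\<close>, the modulus stays strictly below 1 even for
    \<open>a = b\<close>, so the root containing it never vanishes on the unit interval.\<close>
  have \<kappa>lt: "\<kappa>\<^sup>2 < 1"
    using ab4 d R2 Rpos by (simp add: \<kappa>2 divide_less_eq add_strict_increasing)
  have \<kappa>t: "1 - \<kappa>\<^sup>2 * t\<^sup>2 > 0" if "t \<in> {0..1}" for t
  proof -
    have "\<kappa>\<^sup>2 * t\<^sup>2 \<le> \<kappa>\<^sup>2 * 1" using that by (intro mult_left_mono) (auto simp: power_le_one)
    then show ?thesis using \<kappa>lt by simp
  qed
  have \<kappa>ne: "sqrt (1 - \<kappa>\<^sup>2 * t\<^sup>2) \<noteq> 0" if "t \<in> {0..1}" for t
    using \<kappa>t[OF that] by simp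
  have Rk: "R * sqrt (1 - \<kappa>\<^sup>2 * t\<^sup>2) = sqrt (d\<^sup>2 + (a + b)\<^sup>2 - 4 * a * b * t\<^sup>2)" for t
  proof -
    have "R * sqrt (1 - \<kappa>\<^sup>2 * t\<^sup>2) = sqrt (R\<^sup>2 * (1 - \<kappa>\<^sup>2 * t\<^sup>2))"
      using Rpos by (simp add: real_sqrt_mult)
    also have "R\<^sup>2 * (1 - \<kappa>\<^sup>2 * t\<^sup>2) = R\<^sup>2 - 4 * a * b * t\<^sup>2"
      using Rpos by (simp add: \<kappa>2 right_diff_distrib)
    finally show ?thesis by (simp add: R2)
  qed
  have S_eq: "S \<alpha> = R * sqrt (1 - \<kappa>\<^sup>2 * (sin \<alpha>)\<^sup>2)" for \<alpha>
    by (simp add: Rk S_def)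
  have S_app: "sqrt (d\<^sup>2 + (a + b)\<^sup>2 - 4 * a * b * (sin \<alpha>)\<^sup>2) = S \<alpha>" for \<alpha>
    by (simp add: S_def)
  have q_nonneg: "q \<alpha> \<ge> 0" for \<alpha>
  proof -
    have "4 * a * b * (sin \<alpha>)\<^sup>2 \<le> 4 * a * b * 1"
      using a b by (intro mult_left_mono) (auto simp: abs_square_le_1)
    then show ?thesis using ab4 by (simp add: q_def)
  qed
  have S2: "(S \<alpha>)\<^sup>2 = d\<^sup>2 + q \<alpha>" for \<alpha>
  proof -
    have "S \<alpha> = sqrt (d\<^sup>2 + q \<alpha>)" by (simp add: S_def q_def)
    then show ?thesis using q_nonneg[of \<alpha>] by simp
  qed
  have Spos: "S \<alpha> > 0" for \<alpha>
  proof -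
    have "0 < d\<^sup>2 + q \<alpha>" using q_nonneg[of \<alpha>] d by (intro add_pos_nonneg) auto
    then show ?thesis by (simp add: S_def q_def)
  qed
  have contS [continuous_intros]: "continuous_on A S" for A
    unfolding S_def by (intro continuous_intros)
  have contq [continuous_intros]: "continuous_on A q" for A
    unfolding q_def by (intro continuous_intros)
  have int_cont: "(h has_integral integral {0..pi/2} h) {0..pi/2}" if "continuous_on {0..pi/2} h" for h :: "real \<Rightarrow> real"
    using integrable_continuous_real[OF that] by (simp add: has_integral_integral)
  have E: "(S has_integral R * elliptic_E \<kappa>) {0..pi/2}"
  proof -
    have "elliptic_E \<kappa> = integral {0..pi/2} (\<lambda>\<alpha>. sqrt (1 - \<kappa>\<^sup>2 * (sin \<alpha>)\<^sup>2))"
      unfolding elliptic_E_def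
      by (rule LBINT_arcsine_weight) (use \<kappa>t in \<open>auto intro!: continuous_intros simp: less_imp_le\<close>)
    then have "R * elliptic_E \<kappa> = integral {0..pi/2} S"
      by (simp add: S_eq[abs_def])
    then show ?thesis by (simp add: int_cont contS)
  qed
  have lin: "a * (a - b * (2 * (sin \<alpha>)\<^sup>2 - 1)) = (q \<alpha> + a\<^sup>2 - b\<^sup>2) / 2" for \<alpha>
    by (simp add: q_def power2_eq_square algebra_simps)
  show ?thesis
  proof (cases "a = b")
    case True
    \<comment> \<open>For \<open>a = b\<close> the function \<open>q\<close> vanishes at
      \<open>pi/2\<close>, so nothing is divided by \<open>q\<close>. Instead \<open>q\<close>
      factors as \<open>(S - d) * (S + d)\<close> and the denominator cancels; the constant
      \<open>d / 2\<close> accounts for the value 1/2 of the step function at 0.\<close>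
    have "a * (a - b * (2 * (sin \<alpha>)\<^sup>2 - 1)) / (S \<alpha> + d) = (S \<alpha> - d) / 2" for \<alpha>
    proof -
      have "q \<alpha> = (S \<alpha> - d) * (S \<alpha> + d)" using S2[of \<alpha>] by (simp add: power2_eq_square algebra_simps)
      then show ?thesis using lin[of \<alpha>] True Spos[of \<alpha>] d by simp
    qed
    moreover have "((\<lambda>\<alpha>. (S \<alpha> - d) / 2) has_integral (R * elliptic_E \<kappa> - (pi/2 - 0) * d) / 2) {0..pi/2}"
      using has_integral_const_real[of d 0 "pi/2"]
      by (intro has_integral_divide has_integral_diff E) simp
    moreover have "(R * elliptic_E \<kappa> - (pi/2 - 0) * d) / 2 = pi * a * Y a b d / 2"
    proof -
      have "Y a b d = R / (pi * a) * elliptic_E \<kappa> - d / a * (1 / 2)"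
        unfolding Y_def Let_def R_def[symmetric] \<kappa>_def[symmetric] using True by (simp add: unit_step_def)
      then show ?thesis using a by (simp add: field_simps)
    qed
    ultimately show ?thesis by (simp only: S_app)
  next
    case False
    define B where "B = \<bar>a - b\<bar>"
    have Bpos: "B > 0" using False by (simp add: B_def)
    have apb: "a + b > 0" using a b by simp
    have q_eq: "q \<alpha> = (a + b)\<^sup>2 * (cos \<alpha>)\<^sup>2 + B\<^sup>2 * (sin \<alpha>)\<^sup>2" for \<alpha>
    proof -
      have "B\<^sup>2 = (a - b)\<^sup>2" by (simp add: B_def)
      then show ?thesis using sin_cos_squared_add[of \<alpha>] unfolding q_def by algebra
    qed
    have ab4': "4 * a * b < (a + b)\<^sup>2"
      using Bpos zero_less_power2[of "a - b"] by (simp add: B_def power2_eq_square algebra_simps)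
    have qt: "(a + b)\<^sup>2 * (1 - \<nu> * t\<^sup>2) = (a + b)\<^sup>2 - 4 * a * b * t\<^sup>2" for t
      using apb by (simp add: \<nu>_def right_diff_distrib)
    have \<nu>t: "1 - \<nu> * t\<^sup>2 > 0" if "t \<in> {0..1}" for t
    proof -
      have "\<nu> * t\<^sup>2 \<le> \<nu> * 1" using that a b
        by (intro mult_left_mono) (auto simp: power_le_one \<nu>_def)
      also have "\<nu> * 1 < 1" using ab4' apb by (simp add: \<nu>_def)
      finally show ?thesis by simp
    qed
    have qpos: "q \<alpha> > 0" for \<alpha>
    proof -
      have "4 * a * b * (sin \<alpha>)\<^sup>2 \<le> 4 * a * b * 1"
        using a b by (intro mult_left_mono) (auto simp: abs_square_le_1)
      then show ?thesis using ab4' by (simp add: q_def)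
    qed
    have Sne: "S \<alpha> \<noteq> 0" and qne: "q \<alpha> \<noteq> 0" for \<alpha>
      using Spos[of \<alpha>] qpos[of \<alpha>] by simp_all
    have K: "((\<lambda>\<alpha>. 1 / S \<alpha>) has_integral elliptic_K \<kappa> / R) {0..pi/2}"
    proof -
      have "elliptic_K \<kappa> = (LBINT t:{0..1}. (1 / sqrt (1 - \<kappa>\<^sup>2 * t\<^sup>2)) / sqrt (1 - t\<^sup>2))"
        by (simp add: elliptic_K_def mult.commute)
      also have "\<dots> = integral {0..pi/2} (\<lambda>\<alpha>. 1 / sqrt (1 - \<kappa>\<^sup>2 * (sin \<alpha>)\<^sup>2))"
      proof (rule LBINT_arcsine_weight)
        show "continuous_on {0..1} (\<lambda>t. 1 / sqrt (1 - \<kappa>\<^sup>2 * t\<^sup>2))"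
          by (intro continuous_intros ballI \<kappa>ne)
        show "0 \<le> 1 / sqrt (1 - \<kappa>\<^sup>2 * t\<^sup>2)" if "t \<in> {0..1}" for t
          using \<kappa>t[OF that] by simp
      qed
      finally have "elliptic_K \<kappa> / R = integral {0..pi/2} (\<lambda>\<alpha>. 1 / S \<alpha>)"
        by (simp add: S_eq[abs_def] integral_divide[symmetric] mult.commute)
      moreover have "continuous_on {0..pi/2} (\<lambda>\<alpha>. 1 / S \<alpha>)"
        by (intro continuous_intros ballI Sne)
      ultimately show ?thesis by (simp add: int_cont)
    qed
    have P: "((\<lambda>\<alpha>. 1 / (q \<alpha> * S \<alpha>)) has_integral elliptic_Pi \<nu> \<kappa> / ((a + b)\<^sup>2 * R)) {0..pi/2}"
    proof -
      have "elliptic_Pi \<nu> \<kappa> = (LBINT t:{0..1}. (1 / ((1 - \<nu> * t\<^sup>2) * sqrt (1 - \<kappa>\<^sup>2 * t\<^sup>2))) / sqrt (1 - t\<^sup>2))"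
        by (simp add: elliptic_Pi_def mult_ac)
      also have "\<dots> = integral {0..pi/2} (\<lambda>\<alpha>. 1 / ((1 - \<nu> * (sin \<alpha>)\<^sup>2) * sqrt (1 - \<kappa>\<^sup>2 * (sin \<alpha>)\<^sup>2)))"
      proof (rule LBINT_arcsine_weight)
        show "continuous_on {0..1} (\<lambda>t. 1 / ((1 - \<nu> * t\<^sup>2) * sqrt (1 - \<kappa>\<^sup>2 * t\<^sup>2)))"
          by (intro continuous_intros ballI no_zero_divisors \<kappa>ne \<nu>t[THEN less_imp_neq, THEN not_sym])
        show "0 \<le> 1 / ((1 - \<nu> * t\<^sup>2) * sqrt (1 - \<kappa>\<^sup>2 * t\<^sup>2))" if "t \<in> {0..1}" for t
          using \<kappa>t[OF that] \<nu>t[OF that] by simp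
      qed
      finally have "elliptic_Pi \<nu> \<kappa> / ((a + b)\<^sup>2 * R) =
          integral {0..pi/2} (\<lambda>\<alpha>. 1 / (((a + b)\<^sup>2 * (1 - \<nu> * (sin \<alpha>)\<^sup>2)) * (R * sqrt (1 - \<kappa>\<^sup>2 * (sin \<alpha>)\<^sup>2))))"
        by (simp add: integral_divide[symmetric] mult_ac)
      also have "\<dots> = integral {0..pi/2} (\<lambda>\<alpha>. 1 / (q \<alpha> * S \<alpha>))"
        unfolding qt S_eq q_def ..
      finally have eq: "elliptic_Pi \<nu> \<kappa> / ((a + b)\<^sup>2 * R) = integral {0..pi/2} (\<lambda>\<alpha>. 1 / (q \<alpha> * S \<alpha>))" .
      have "continuous_on {0..pi/2} (\<lambda>\<alpha>. 1 / (q \<alpha> * S \<alpha>))"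
        by (intro continuous_intros ballI no_zero_divisors Sne qne)
      then show ?thesis unfolding eq by (rule int_cont)
    qed
    have Q: "((\<lambda>\<alpha>. 1 / q \<alpha>) has_integral pi / (2 * (a + b) * B)) {0..pi/2}"
      unfolding q_eq by (rule has_integral_inverse_quadratic_trig[OF apb Bpos])
    have "a * (a - b * (2 * (sin \<alpha>)\<^sup>2 - 1)) / (S \<alpha> + d) =
      S \<alpha> / 2 + (a\<^sup>2 - b\<^sup>2) / 2 * (1 / S \<alpha> + d\<^sup>2 * (1 / (q \<alpha> * S \<alpha>))) - d / 2 - d * (a\<^sup>2 - b\<^sup>2) / 2 * (1 / q \<alpha>)" for \<alpha>
    proof -
      have q: "q \<alpha> = (S \<alpha> - d) * (S \<alpha> + d)" using S2[of \<alpha>] by (simp add: power2_eq_square algebra_simps)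
      have "1 / S \<alpha> + d\<^sup>2 * (1 / (q \<alpha> * S \<alpha>)) = (q \<alpha> + d\<^sup>2) / (q \<alpha> * S \<alpha>)"
        using Spos[of \<alpha>] qpos[of \<alpha>] by (simp add: field_simps)
      also have "\<dots> = S \<alpha> / q \<alpha>"
      proof -
        have "q \<alpha> + d\<^sup>2 = S \<alpha> * S \<alpha>" using S2[of \<alpha>] by (simp add: power2_eq_square)
        then show ?thesis using Spos[of \<alpha>] by simp
      qed
      finally have 1: "1 / S \<alpha> + d\<^sup>2 * (1 / (q \<alpha> * S \<alpha>)) = S \<alpha> / q \<alpha>" .
      have 2: "1 / (S \<alpha> + d) = (S \<alpha> - d) / q \<alpha>"
        using q Spos[of \<alpha>] d qpos[of \<alpha>] by auto
      have "a * (a - b * (2 * (sin \<alpha>)\<^sup>2 - 1)) / (S \<alpha> + d) = (q \<alpha> + a\<^sup>2 - b\<^sup>2) / 2 * (1 / (S \<alpha> + d))"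
        unfolding lin by simp
      also have "\<dots> = S \<alpha> / 2 + (a\<^sup>2 - b\<^sup>2) / 2 * (S \<alpha> / q \<alpha>) - d / 2 - d * (a\<^sup>2 - b\<^sup>2) / 2 * (1 / q \<alpha>)"
        unfolding 2 using qpos[of \<alpha>] by (simp add: field_simps)
      finally show ?thesis unfolding 1 .
    qed
    moreover have "((\<lambda>\<alpha>. S \<alpha> / 2 + (a\<^sup>2 - b\<^sup>2) / 2 * (1 / S \<alpha> + d\<^sup>2 * (1 / (q \<alpha> * S \<alpha>))) - d / 2 - d * (a\<^sup>2 - b\<^sup>2) / 2 * (1 / q \<alpha>))
      has_integral R * elliptic_E \<kappa> / 2 + (a\<^sup>2 - b\<^sup>2) / 2 * (elliptic_K \<kappa> / R + d\<^sup>2 * (elliptic_Pi \<nu> \<kappa> / ((a + b)\<^sup>2 * R)))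
        - (pi/2 - 0) * (d/2) - d * (a\<^sup>2 - b\<^sup>2) / 2 * (pi / (2 * (a + b) * B))) {0..pi/2}"
      using has_integral_const_real[of "d/2" 0 "pi/2"]
      by (intro has_integral_divide has_integral_diff has_integral_add has_integral_mult_right E K P Q) simp
    moreover have "R * elliptic_E \<kappa> / 2 + (a\<^sup>2 - b\<^sup>2) / 2 * (elliptic_K \<kappa> / R + d\<^sup>2 * (elliptic_Pi \<nu> \<kappa> / ((a + b)\<^sup>2 * R)))
        - (pi/2 - 0) * (d/2) - d * (a\<^sup>2 - b\<^sup>2) / 2 * (pi / (2 * (a + b) * B)) = pi * a * Y a b d / 2"
    proof -
      have ab: "a\<^sup>2 - b\<^sup>2 = (a - b) * (a + b)" by (simp add: power2_eq_square algebra_simps)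
      \<comment> \<open>The Poisson kernel contributes the sign of \<open>a - b\<close>, which is
        twice the step function minus 1. The part coming from this minus 1 cancels the constant term
        \<open>(pi/2 - 0) * (d/2)\<close>, and only the step function remains.\<close>
      have step: "(a - b) / B = 2 * unit_step (a - b) - 1"
        using False minus_divide_left[of "b - a" "b - a"] by (simp add: B_def unit_step_def abs_if)
      have 1: "d * (a\<^sup>2 - b\<^sup>2) / 2 * (pi / (2 * (a + b) * B)) = d * pi / 4 * (2 * unit_step (a - b) - 1)"
      proof -
        have "d * ((a - b) * s) / 2 * (pi / (2 * s * B)) = d * pi / 4 * ((a - b) / B)" if "s > 0" for s :: real
          using that Bpos by (simp add: field_simps)
        then show ?thesis unfolding step[symmetric] ab using apb by blast
      qed
      have 2: "(a\<^sup>2 - b\<^sup>2) / 2 * (d\<^sup>2 * (elliptic_Pi \<nu> \<kappa> / ((a + b)\<^sup>2 * R))) = d\<^sup>2 * (a - b) / (2 * (a + b) * R) * elliptic_Pi \<nu> \<kappa>"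
      proof -
        have "(a - b) * s / 2 * (d\<^sup>2 * (p / (s\<^sup>2 * R))) = d\<^sup>2 * (a - b) / (2 * s * R) * p" if "s > 0" for s p :: real
          using that Rpos by (simp add: field_simps power2_eq_square)
        then show ?thesis unfolding ab using apb by blast
      qed
      have Yeq: "Y a b d = R / (pi * a) * elliptic_E \<kappa> + ((a\<^sup>2 - b\<^sup>2) / (pi * a * R) * elliptic_K \<kappa>
                 + d\<^sup>2 * (a - b) / (pi * a * (a + b) * R) * elliptic_Pi \<nu> \<kappa>) - d / a * unit_step (a - b)"
        using False by (simp add: Y_def Let_def R_def[symmetric] \<kappa>_def[symmetric] \<nu>_def[symmetric])
      have 3: "pi * a * Y a b d / 2 = R * elliptic_E \<kappa> / 2 + (a\<^sup>2 - b\<^sup>2) / (2 * R) * elliptic_K \<kappa>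
                 + d\<^sup>2 * (a - b) / (2 * (a + b) * R) * elliptic_Pi \<nu> \<kappa> - d * pi / 2 * unit_step (a - b)"
      proof -
        have "pi * a * (R / (pi * a) * x + (m / (pi * a * R) * k + n / (pi * a * s * R) * p) - d / a * u) / 2
          = R * x / 2 + m / (2 * R) * k + n / (2 * s * R) * p - d * pi / 2 * u" if "s > 0" for x m k n s p u :: real
          using a that Rpos by (simp add: field_simps)
        then show ?thesis unfolding Yeq using apb by blast
      qed
      have 4: "m / 2 * (k / R + x) = m / (2 * R) * k + m / 2 * x" for m k x :: real
        by (simp add: distrib_left)
      show ?thesis unfolding 4 1 2 3 by (simp add: right_diff_distrib)
    qed
    ultimately show ?thesis by (simp only: S_app)
  qed
qed

section \<open>The potential of a disk\<close>

lemma integral_periodic_shift: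
  fixes f :: "real \<Rightarrow> real"
  assumes cont: "continuous_on UNIV f" and periodic: "\<And>x. f (x + T) = f x" and "T \<ge> 0"
  shows "integral {c..c + T} f = integral {e..e + T} f"
proof -
  have int: "f integrable_on {u..v}" for u v
    by (rule integrable_continuous_real) (rule continuous_on_subset[OF cont], simp)
  \<comment> \<open>The window starting at \<open>c\<close> lacks \<open>{c + T..e + T}\<close> to
    fill \<open>{c..e + T}\<close>, the one starting at \<open>e\<close> lacks
    \<open>{c..e}\<close>, and the two missing pieces differ by one period.\<close>
  have *: "integral {c..c + T} f = integral {e..e + T} f" if "c \<le> e" for c e
  proof -
    have "integral {c..e} f + integral {e..e + T} f = integral {c..e + T} f"
      by (rule Henstock_Kurzweil_Integration.integral_combine) (use that \<open>T \<ge> 0\<close> int in auto)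
    moreover have "integral {c..c + T} f + integral {c + T..e + T} f = integral {c..e + T} f"
      by (rule Henstock_Kurzweil_Integration.integral_combine) (use that \<open>T \<ge> 0\<close> int in auto)
    moreover have "integral {c + T..e + T} f = integral {c..e} f"
      using integral_shift_real_ivl[of "c + T" T "e + T" f] by (simp add: periodic)
    ultimately show ?thesis by simp
  qed
  show ?thesis using *[of c e] *[of e c] by fastforce
qed

lemma integral_periodic_translate:
  fixes f :: "real \<Rightarrow> real"
  assumes cont: "continuous_on UNIV f" and periodic: "\<And>x. f (x + 2 * pi) = f x"
  shows "integral {- pi..pi} (\<lambda>x. f (x + c)) = integral {- pi..pi} f"
  using integral_shift_real_ivl[of "c - pi" c "c + pi" f] integral_periodic_shift[OF cont periodic, of "c - pi" "- pi"]
  by (simp add: add.commute)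

text \<open>Shifting by \<open>pi\<close> replaces \<open>cos\<close> by \<open>- cos\<close>,
  evenness halves the interval, and \<open>\<theta> = 2 * \<alpha>\<close> gives
  \<open>- cos (2 * \<alpha>) = 2 * (sin \<alpha>)\<^sup>2 - 1\<close>. The shift is what produces
  the sine, as in the standard form of the elliptic integrals.\<close>

lemma integral_cos_half_angle:
  fixes F :: "real \<Rightarrow> real"
  assumes F: "continuous_on {-1..1} F"
  shows "integral {- pi..pi} (\<lambda>\<theta>. F (cos \<theta>)) = 4 * integral {0..pi/2} (\<lambda>\<alpha>. F (2 * (sin \<alpha>)\<^sup>2 - 1))"
proof -
  have cont: "continuous_on A (\<lambda>\<theta>. F (cos \<theta>))" "continuous_on A (\<lambda>\<theta>. F (- cos \<theta>))" for A
    by (rule continuous_on_compose2[OF F]; auto intro!: continuous_intros simp: minus_le_iff)+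
  have "integral {- pi..pi} (\<lambda>\<theta>. F (cos \<theta>)) = integral {- pi..pi} (\<lambda>\<theta>. F (- cos \<theta>))"
    using integral_periodic_translate[OF cont(1), of pi] by simp
  also have "\<dots> = integral {- pi..0} (\<lambda>\<theta>. F (- cos \<theta>)) + integral {0..pi} (\<lambda>\<theta>. F (- cos \<theta>))"
    by (rule Henstock_Kurzweil_Integration.integral_combine[symmetric]) (auto intro!: integrable_continuous_real cont)
  also have "integral {- pi..0} (\<lambda>\<theta>. F (- cos \<theta>)) = integral {0..pi} (\<lambda>\<theta>. F (- cos \<theta>))"
    using Henstock_Kurzweil_Integration.integral_reflect_real[of pi 0 "\<lambda>\<theta>. F (- cos \<theta>)"] by simp
  also have "((\<lambda>\<alpha>. 2 *\<^sub>R F (- cos (2 * \<alpha>))) has_integral integral {2 * 0..2 * (pi/2)} (\<lambda>\<theta>. F (- cos \<theta>))) {0..pi/2}"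
    by (rule has_integral_substitution[where c = 0 and d = pi and f = "\<lambda>\<theta>. F (- cos \<theta>)" and g = "\<lambda>\<alpha>. 2 * \<alpha>" and g' = "\<lambda>_. 2"])
      (auto intro!: cont derivative_eq_intros)
  then have "integral {0..pi} (\<lambda>\<theta>. F (- cos \<theta>)) = integral {0..pi/2} (\<lambda>\<alpha>. 2 * F (2 * (sin \<alpha>)\<^sup>2 - 1))"
    by (simp add: has_integral_iff cos_double_sin)
  finally show ?thesis by simp
qed

section \<open>Green's theorem on a disk\<close>

text \<open>This is the divergence theorem for the field \<open>(V, 0)\<close>:
  \<open>cos \<theta>\<close> is the first component of the outer normal, and the circle has line
  element \<open>a\<close> times that of \<open>\<theta>\<close>. The partial derivative is
  integrated along horizontal chords, and \<open>y = a * sin \<theta>\<close> parametrises their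
  ends.\<close>

lemma LBINT_disk_partial_derivative:
  fixes V g :: "real \<times> real \<Rightarrow> real"
  assumes a: "a > 0" and V: "continuous_on UNIV V" and g: "continuous_on UNIV g"
    and deriv: "\<And>x y. ((\<lambda>x. V (x, y)) has_real_derivative g (x, y)) (at x)"
  shows "(LBINT p:cball 0 a. g p) = integral {- pi..pi} (\<lambda>\<theta>. a * cos \<theta> * V (a * cos \<theta>, a * sin \<theta>))"
proof -
  define h where "h y = sqrt (a\<^sup>2 - y\<^sup>2)" for y
  define k where "k y = V (h y, y) - V (- h y, y)" for y
  define W where "W \<theta> = a * cos \<theta> * V (a * cos \<theta>, a * sin \<theta>)" for \<theta>
  have contV: "continuous_on A (\<lambda>x. V (u x, v x))" if "continuous_on A u" "continuous_on A v" for A and u v :: "real \<Rightarrow> real"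
    by (rule continuous_on_compose2[OF V]) (use that in \<open>auto intro!: continuous_intros\<close>)
  have contW: "continuous_on A W" for A
    unfolding W_def by (intro continuous_intros contV)
  have contk: "continuous_on A k" for A
    unfolding k_def h_def by (intro continuous_intros contV)
  have mem: "(x, y) \<in> cball 0 a \<longleftrightarrow> y \<in> {- a..a} \<and> x \<in> {- h y..h y}" for x y
  proof -
    have "(x, y) \<in> cball 0 a \<longleftrightarrow> x\<^sup>2 + y\<^sup>2 \<le> a\<^sup>2"
      using a real_sqrt_le_iff[of "x\<^sup>2 + y\<^sup>2" "a\<^sup>2"] by (simp add: norm_Pair)
    also have "\<dots> \<longleftrightarrow> y\<^sup>2 \<le> a\<^sup>2 \<and> \<bar>x\<bar> \<le> h y"
    proof
      assume *: "x\<^sup>2 + y\<^sup>2 \<le> a\<^sup>2"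
      then have "y\<^sup>2 \<le> a\<^sup>2" using zero_le_power2[of x] by linarith
      moreover have "\<bar>x\<bar> \<le> h y" unfolding h_def using * by (intro real_le_rsqrt) simp
      ultimately show "y\<^sup>2 \<le> a\<^sup>2 \<and> \<bar>x\<bar> \<le> h y" by simp
    next
      assume *: "y\<^sup>2 \<le> a\<^sup>2 \<and> \<bar>x\<bar> \<le> h y"
      then have "\<bar>x\<bar>\<^sup>2 \<le> (h y)\<^sup>2" by (intro power_mono) auto
      then show "x\<^sup>2 + y\<^sup>2 \<le> a\<^sup>2" using * by (simp add: h_def)
    qed
    also have "y\<^sup>2 \<le> a\<^sup>2 \<longleftrightarrow> \<bar>y\<bar> \<le> a" using a abs_le_square_iff[of y a] by simp
    finally show ?thesis by auto
  qed
  have hnn: "h y \<ge> 0" if "y \<in> {- a..a}" for y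
    using that abs_le_square_iff[of y a] a by (simp add: h_def abs_le_iff)
  have "integrable (lborel \<Otimes>\<^sub>M lborel) (\<lambda>p. indicator (cball 0 a) p *\<^sub>R g p)"
    unfolding lborel_prod
    by (rule borel_integrable_compact) (auto intro: continuous_on_subset[OF g])
  then have int: "integrable (lborel \<Otimes>\<^sub>M lborel) (\<lambda>(x, y). indicator (cball 0 a) (x, y) *\<^sub>R g (x, y))"
    by (simp add: case_prod_unfold)
  have inner: "(LBINT x. indicator (cball 0 a) (x, y) *\<^sub>R g (x, y)) = indicator {- a..a} y *\<^sub>R k y" for y
  proof (cases "y \<in> {- a..a}")
    case True
    have "(LBINT x. indicator (cball 0 a) (x, y) *\<^sub>R g (x, y)) = (LBINT x. indicator {- h y..h y} x *\<^sub>R g (x, y))"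
      using True by (intro Bochner_Integration.integral_cong refl) (simp only: indicator_def mem simp_thms)
    also have "\<dots> = V (h y, y) - V (- h y, y)"
      by (rule integral_FTC_Icc)
        (use hnn[OF True] in \<open>auto simp: has_real_derivative_iff_has_vector_derivative[symmetric]
            intro!: has_field_derivative_at_within deriv continuous_on_compose2[OF g] continuous_intros\<close>)
    finally show ?thesis using True by (simp add: k_def)
  next
    case False
    then have "indicator (cball 0 a) (x, y) = (0::real)" for x :: real
      unfolding indicator_def mem by auto
    then show ?thesis using False by simp
  qed
  have "(LBINT p:cball 0 a. g p) = (LINT p|(lborel \<Otimes>\<^sub>M lborel). indicator (cball 0 a) p *\<^sub>R g p)"
    by (simp only: set_lebesgue_integral_def lborel_prod)
  also have "\<dots> = (LBINT y. LBINT x. indicator (cball 0 a) (x, y) *\<^sub>R g (x, y))"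
    using lborel_pair.integral_snd[OF int] by (simp add: case_prod_unfold)
  also have "\<dots> = (LBINT y:{- a..a}. k y)"
    by (simp only: inner set_lebesgue_integral_def)
  also have "\<dots> = integral {- a..a} k"
    by (intro set_borel_integral_eq_integral borel_integrable_atLeastAtMost' contk)
  also have "\<dots> = integral {- (pi/2)..pi/2} (\<lambda>\<theta>. (a * cos \<theta>) *\<^sub>R k (a * sin \<theta>))"
  proof -
    have "((\<lambda>\<theta>. (a * cos \<theta>) *\<^sub>R k (a * sin \<theta>)) has_integral integral {a * sin (- (pi/2))..a * sin (pi/2)} k) {- (pi/2)..pi/2}"
    proof (rule has_integral_substitution[where c = "- a" and d = a and f = k and g = "\<lambda>\<theta>. a * sin \<theta>" and g' = "\<lambda>\<theta>. a * cos \<theta>"])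
      show "(\<lambda>\<theta>. a * sin \<theta>) ` {- (pi / 2)..pi / 2} \<subseteq> {- a..a}"
      proof -
        have "\<bar>a * sin \<theta>\<bar> \<le> a" for \<theta>
          using a mult_left_mono[OF abs_sin_le_one, of a \<theta>] by (simp add: abs_mult)
        then show ?thesis by (auto simp: abs_le_iff minus_le_iff)
      qed
    qed (use a in \<open>auto intro!: contk derivative_eq_intros\<close>)
    then show ?thesis by (simp add: has_integral_iff)
  qed
  \<comment> \<open>The right end of a chord lies at angle \<open>\<theta>\<close>, the left end at
    \<open>pi - \<theta>\<close>. The cosine is negated there, which absorbs the minus sign in
    \<open>k\<close>, so that both halves of the circle carry the same integrand
    \<open>W\<close>.\<close>
  also have "\<dots> = integral {- (pi/2)..pi/2} (\<lambda>\<theta>. W \<theta> + W (pi - \<theta>))"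
  proof (rule integral_cong)
    fix \<theta> assume "\<theta> \<in> {- (pi/2)..pi/2}"
    then have "cos \<theta> \<ge> 0" by (intro cos_ge_zero) auto
    moreover have "a\<^sup>2 - (a * sin \<theta>)\<^sup>2 = (a * cos \<theta>)\<^sup>2"
      by (simp add: power_mult_distrib cos_squared_eq algebra_simps)
    ultimately have "h (a * sin \<theta>) = a * cos \<theta>" using a by (simp add: h_def)
    then show "(a * cos \<theta>) *\<^sub>R k (a * sin \<theta>) = W \<theta> + W (pi - \<theta>)"
      by (simp add: k_def W_def algebra_simps)
  qed
  also have "\<dots> = integral {- (pi/2)..pi/2} W + integral {- (pi/2)..pi/2} (\<lambda>\<theta>. W (pi - \<theta>))"
    by (intro Henstock_Kurzweil_Integration.integral_add integrable_continuous_real contW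
        continuous_on_compose2[OF contW] continuous_intros) auto
  also have "integral {- (pi/2)..pi/2} (\<lambda>\<theta>. W (pi - \<theta>)) = integral {pi/2..3 * pi/2} W"
    using Henstock_Kurzweil_Integration.integral_reflect_real[of "pi/2" "- (pi/2)" "\<lambda>\<theta>. W (\<theta> + pi)"] integral_shift_real_ivl[of "pi/2" pi "3*pi/2" W]
    by (simp add: add.commute)
  also have "integral {- (pi/2)..pi/2} W + integral {pi/2..3 * pi/2} W = integral {- (pi/2)..3 * pi/2} W"
    by (rule Henstock_Kurzweil_Integration.integral_combine) (auto intro!: integrable_continuous_real contW)
  also have "\<dots> = integral {- pi..pi} W"
    using integral_periodic_shift[of W "2 * pi" "- (pi/2)" "- pi"] contW by (simp add: W_def)
  finally show ?thesis by (simp add: W_def[abs_def])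
qed

text \<open>The disk is symmetric in the diagonal. This derives the \<open>y\<close>-part of the
  divergence from the \<open>x\<close>-part with the coordinates exchanged.\<close>

lemma LBINT_disk_swap:
  fixes f :: "real \<times> real \<Rightarrow> real"
  assumes f: "f \<in> borel_measurable borel"
  shows "(LBINT p:cball 0 a. f (snd p, fst p)) = (LBINT p:cball 0 a. f p)"
proof -
  have ind: "indicat_real (cball 0 a) (y, x) = indicator (cball 0 a) (x, y)" for x y :: real
    by (simp add: indicator_def norm_Pair add.commute)
  have "(\<lambda>p. indicator (cball 0 a) p *\<^sub>R f p) \<in> borel_measurable (borel :: (real \<times> real) measure)"
    by (intro borel_measurable_scaleR borel_measurable_indicator f) simp
  then have meas: "(\<lambda>p. indicator (cball 0 a) p *\<^sub>R f p) \<in> borel_measurable (lborel \<Otimes>\<^sub>M (lborel :: real measure))"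
    by (simp add: lborel_prod)
  have "(LBINT p:cball 0 a. f (snd p, fst p)) = (LINT (x, y)|(lborel \<Otimes>\<^sub>M lborel). indicator (cball 0 a) (y, x) *\<^sub>R f (y, x))"
    by (simp add: set_lebesgue_integral_def lborel_prod case_prod_unfold ind)
  also have "\<dots> = (LINT p|(lborel \<Otimes>\<^sub>M lborel). indicator (cball 0 a) p *\<^sub>R f p)"
    by (rule lborel_pair.integral_product_swap[OF meas])
  finally show ?thesis by (simp add: set_lebesgue_integral_def lborel_prod)
qed

section \<open>The field and its flux through the boundary circle\<close>

text \<open>The function differentiated is the first component of the field
  \<open>r / (S + d)\<close>, the planar gradient of \<open>S - d * ln (S + d)\<close>. In the
  quotient rule, \<open>S\<^sup>2 - (x - p)\<^sup>2 = d\<^sup>2 + y\<^sup>2\<close> removes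
  \<open>x - p\<close> from the numerator.\<close>

lemma has_real_derivative_potential_field:
  fixes d y :: real
  assumes d: "d > 0"
  defines "S \<equiv> \<lambda>x. sqrt (d\<^sup>2 + x\<^sup>2 + y\<^sup>2)"
  shows "((\<lambda>x. (x - p) / (S (x - p) + d)) has_real_derivative
    (d * S (x - p) + d\<^sup>2 + y\<^sup>2) / (S (x - p) * (S (x - p) + d)\<^sup>2)) (at x)"
proof -
  have pos: "d\<^sup>2 + u\<^sup>2 + y\<^sup>2 > 0" for u using d by (intro add_pos_nonneg) auto
  then have Spos: "S u > 0" for u by (simp add: S_def)
  have S2: "(S u)\<^sup>2 = d\<^sup>2 + u\<^sup>2 + y\<^sup>2" for u using pos[of u] by (simp add: S_def)
  have DS: "((\<lambda>x. S (x - p)) has_real_derivative (x - p) / S (x - p)) (at x)"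
    unfolding S_def by (rule derivative_eq_intros refl | use pos[of "x - p"] in \<open>simp add: field_simps\<close>)+
  have "((\<lambda>x. (x - p) / (S (x - p) + d)) has_real_derivative
    (1 * (S (x - p) + d) - (x - p) * ((x - p) / S (x - p))) / ((S (x - p) + d) * (S (x - p) + d))) (at x)"
    using DS Spos[of "x - p"] d by (intro DERIV_divide) (auto intro!: derivative_eq_intros)
  also have "1 * (S (x - p) + d) - (x - p) * ((x - p) / S (x - p)) = (d * S (x - p) + d\<^sup>2 + y\<^sup>2) / S (x - p)"
    using Spos[of "x - p"] S2[of "x - p"] by (simp add: field_simps power2_eq_square)
  finally show ?thesis by (simp add: power2_eq_square)
qed

text \<open>This is the share of the first coordinate in the flux. The circle is parametrised from
  the azimuth \<open>\<phi>\<close> of the field's centre, so by the law of cosines the denominator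
  depends on \<open>\<theta>\<close> alone. The second coordinate will be treated by the same lemma
  at the azimuth \<open>pi/2 - \<phi>\<close>.\<close>

lemma LBINT_disk_potential_field:
  fixes a b d \<phi> :: real
  assumes a: "a > 0" and d: "d > 0"
  defines "S \<equiv> \<lambda>p q r. sqrt (d\<^sup>2 + (fst r - p)\<^sup>2 + (snd r - q)\<^sup>2)"
  defines "g \<equiv> \<lambda>p q r. (d * S p q r + d\<^sup>2 + (snd r - q)\<^sup>2) / (S p q r * (S p q r + d)\<^sup>2)"
  shows "(LBINT r:cball 0 a. g (b * cos \<phi>) (b * sin \<phi>) r) =
    integral {- pi..pi} (\<lambda>\<theta>. a * cos (\<theta> + \<phi>) * (a * cos (\<theta> + \<phi>) - b * cos \<phi>) / (sqrt (d\<^sup>2 + (a\<^sup>2 + b\<^sup>2 - 2 * a * b * cos \<theta>)) + d))"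
proof -
  let ?p = "b * cos \<phi>" and ?q = "b * sin \<phi>"
  have Spos: "S p q r > 0" for p q r
    using d by (auto simp: S_def intro!: add_pos_nonneg)
  have ne: "S p q r \<noteq> 0" "S p q r + d \<noteq> 0" for p q r
    using Spos[of p q r] d by linarith+
  have contS: "continuous_on A (S p q)" for A p q
    unfolding S_def by (intro continuous_intros)
  let ?V = "\<lambda>r. (fst r - ?p) / (S ?p ?q r + d)"
  let ?W = "\<lambda>\<theta>. a * cos \<theta> * ?V (a * cos \<theta>, a * sin \<theta>)"
  have contV: "continuous_on UNIV ?V"
    by (intro continuous_intros contS ballI ne)
  have "(LBINT r:cball 0 a. g ?p ?q r) = integral {- pi..pi} ?W"
  proof (rule LBINT_disk_partial_derivative[OF a contV])
    show "continuous_on UNIV (g ?p ?q)"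
      unfolding g_def by (intro continuous_intros contS ballI no_zero_divisors ne) (simp add: ne)
    show "((\<lambda>x. ?V (x, y)) has_real_derivative g ?p ?q (x, y)) (at x)" for x y
      using has_real_derivative_potential_field[OF d, of ?p "y - ?q" x] by (simp add: S_def g_def)
  qed
  also have "\<dots> = integral {- pi..pi} (\<lambda>\<theta>. ?W (\<theta> + \<phi>))"
  proof (rule integral_periodic_translate[symmetric])
    show "continuous_on UNIV ?W"
      by (intro continuous_intros continuous_on_compose2[OF contV]) auto
  qed simp
  also have "(\<lambda>\<theta>. ?W (\<theta> + \<phi>)) = (\<lambda>\<theta>. a * cos (\<theta> + \<phi>) * (a * cos (\<theta> + \<phi>) - b * cos \<phi>) / (sqrt (d\<^sup>2 + (a\<^sup>2 + b\<^sup>2 - 2 * a * b * cos \<theta>)) + d))"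
  proof
    fix \<theta>
    have "cos \<theta> = cos (\<theta> + \<phi>) * cos \<phi> + sin (\<theta> + \<phi>) * sin \<phi>"
      using cos_diff[of "\<theta> + \<phi>" \<phi>] by simp
    then have "(a * cos (\<theta> + \<phi>) - ?p)\<^sup>2 + (a * sin (\<theta> + \<phi>) - ?q)\<^sup>2 = a\<^sup>2 + b\<^sup>2 - 2 * a * b * cos \<theta>"
      using sin_cos_squared_add[of "\<theta> + \<phi>"] sin_cos_squared_add[of \<phi>] by algebra
    then have "S ?p ?q (a * cos (\<theta> + \<phi>), a * sin (\<theta> + \<phi>)) = sqrt (d\<^sup>2 + (a\<^sup>2 + b\<^sup>2 - 2 * a * b * cos \<theta>))"
      by (simp add: S_def add.assoc)
    then show "?W (\<theta> + \<phi>) = a * cos (\<theta> + \<phi>) * (a * cos (\<theta> + \<phi>) - b * cos \<phi>) / (sqrt (d\<^sup>2 + (a\<^sup>2 + b\<^sup>2 - 2 * a * b * cos \<theta>)) + d)"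
      by simp
  qed
  finally show ?thesis .
qed

text \<open>The integrand is the divergence of the field, so the integral is the sum of the two
  coordinate fluxes. Together they have the numerator \<open>a * (a - b * cos \<theta>)\<close>, in
  which \<open>\<phi>\<close> no longer occurs. The half-angle substitution then gives four times
  the integral in \<open>boundary_integral_eq_Y\<close>.\<close>

lemma LBINT_disk_inverse_distance:
  fixes a b d \<phi> :: real
  assumes a: "a > 0" and b: "b \<ge> 0" and d: "d > 0"
  shows "(LBINT r:cball 0 a. 1 / sqrt (d\<^sup>2 + (fst r - b * cos \<phi>)\<^sup>2 + (snd r - b * sin \<phi>)\<^sup>2)) = 2 * pi * a * Y a b d"
proof -
  define S where "S p q r = sqrt (d\<^sup>2 + (fst r - p)\<^sup>2 + (snd r - q)\<^sup>2)" for p q and r :: "real \<times> real"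
  define g where "g p q r = (d * S p q r + d\<^sup>2 + (snd r - q)\<^sup>2) / (S p q r * (S p q r + d)\<^sup>2)" for p q and r :: "real \<times> real"
  let ?p = "b * cos \<phi>" and ?q = "b * sin \<phi>"
  define T where "T \<theta> = sqrt (d\<^sup>2 + (a\<^sup>2 + b\<^sup>2 - 2 * a * b * cos \<theta>))" for \<theta>
  have pos: "d\<^sup>2 + (fst r - p)\<^sup>2 + (snd r - q)\<^sup>2 > 0" for p q and r :: "real \<times> real"
    using d by (intro add_pos_nonneg) auto
  then have Spos: "S p q r > 0" for p q r by (simp add: S_def)
  have ne: "S p q r \<noteq> 0" "S p q r + d \<noteq> 0" for p q r
    using Spos[of p q r] d by linarith+
  have contS: "continuous_on A (S p q)" for A p q
    unfolding S_def by (intro continuous_intros)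
  have contg: "continuous_on A (g p q)" for A p q
    unfolding g_def by (intro continuous_intros contS ballI no_zero_divisors ne) (simp add: ne)
  \<comment> \<open>The numerators of the two partial derivatives add up to
    \<open>(S + d)\<^sup>2\<close>, which cancels against the denominator.\<close>
  have div: "1 / S p q r = g p q r + g q p (snd r, fst r)" for p q r
  proof -
    have S2: "(S p q r)\<^sup>2 = d\<^sup>2 + (fst r - p)\<^sup>2 + (snd r - q)\<^sup>2"
      using pos[of r p q] by (simp add: S_def)
    have swap: "S q p (snd r, fst r) = S p q r" by (simp add: S_def add_ac)
    have "g p q r + g q p (snd r, fst r) =
      (2 * d * S p q r + 2 * d\<^sup>2 + (snd r - q)\<^sup>2 + (fst r - p)\<^sup>2) / (S p q r * (S p q r + d)\<^sup>2)"
      unfolding g_def swap by (simp add: add_divide_distrib[symmetric])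
    also have "2 * d * S p q r + 2 * d\<^sup>2 + (snd r - q)\<^sup>2 + (fst r - p)\<^sup>2 = (S p q r + d)\<^sup>2"
      using S2 by (simp add: power2_sum)
    finally show ?thesis using ne[of p q r] by simp
  qed
  have intg: "set_integrable lborel (cball 0 a) (g p q)" for p q
    unfolding set_integrable_def by (rule borel_integrable_compact) (auto intro: contg)
  have intg': "set_integrable lborel (cball 0 a) (\<lambda>r. g p q (snd r, fst r))" for p q
    unfolding set_integrable_def
    by (rule borel_integrable_compact) (auto intro!: continuous_on_compose2[OF contg] continuous_intros)
  have Tpos: "T \<theta> + d > 0" for \<theta>
  proof -
    have "2 * a * b * cos \<theta> \<le> 2 * a * b * 1" using a b by (intro mult_left_mono) auto
    then have "a\<^sup>2 + b\<^sup>2 - 2 * a * b * cos \<theta> \<ge> 0" using zero_le_power2[of "a - b"] by (simp add: power2_diff)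
    then show ?thesis using d by (simp add: T_def add_nonneg_pos)
  qed
  have Tne: "T \<theta> + d \<noteq> 0" for \<theta> using Tpos[of \<theta>] by simp
  have contT: "continuous_on A T" for A unfolding T_def by (intro continuous_intros)
  have "(LBINT r:cball 0 a. 1 / S ?p ?q r) = (LBINT r:cball 0 a. g ?p ?q r) + (LBINT r:cball 0 a. g ?q ?p (snd r, fst r))"
    unfolding div by (intro set_integral_add intg intg')
  also have "(LBINT r:cball 0 a. g ?q ?p (snd r, fst r)) = (LBINT r:cball 0 a. g ?q ?p r)"
    by (rule LBINT_disk_swap) (intro borel_measurable_continuous_onI contg)
  also have "(LBINT r:cball 0 a. g ?p ?q r) = integral {- pi..pi} (\<lambda>\<theta>. a * cos (\<theta> + \<phi>) * (a * cos (\<theta> + \<phi>) - b * cos \<phi>) / (T \<theta> + d))"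
    unfolding g_def S_def T_def by (rule LBINT_disk_potential_field[OF a d])
  also have "(LBINT r:cball 0 a. g ?q ?p r) = integral {- pi..pi} (\<lambda>\<theta>. a * sin (\<theta> + \<phi>) * (a * sin (\<theta> + \<phi>) - b * sin \<phi>) / (T \<theta> + d))"
  proof -
    \<comment> \<open>Exchanging the coordinates is the reflection in the diagonal, which sends the
      azimuth \<open>\<phi>\<close> to \<open>pi/2 - \<phi>\<close> and reverses the orientation.
      The substitution of \<open>- \<theta>\<close> for \<open>\<theta>\<close> restores it, so that
      both fluxes refer to the same boundary point.\<close>
    let ?h = "\<lambda>\<theta>. a * cos (\<theta> + (pi/2 - \<phi>)) * (a * cos (\<theta> + (pi/2 - \<phi>)) - b * cos (pi/2 - \<phi>)) / (T \<theta> + d)"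
    have "(LBINT r:cball 0 a. g ?q ?p r) = integral {- pi..pi} ?h"
      unfolding g_def S_def T_def
      using LBINT_disk_potential_field[OF a d, of b "pi/2 - \<phi>"] by (simp add: cos_diff sin_diff)
    also have "\<dots> = integral {- pi..pi} (\<lambda>\<theta>. ?h (- \<theta>))"
      using Henstock_Kurzweil_Integration.integral_reflect_real[of pi "- pi" ?h] by simp
    also have "(\<lambda>\<theta>. ?h (- \<theta>)) = (\<lambda>\<theta>. a * sin (\<theta> + \<phi>) * (a * sin (\<theta> + \<phi>) - b * sin \<phi>) / (T \<theta> + d))"
    proof
      fix \<theta>
      have "cos (- \<theta> + (pi/2 - \<phi>)) = cos (pi/2 - (\<theta> + \<phi>))" by (simp add: algebra_simps)
      then have "cos (- \<theta> + (pi/2 - \<phi>)) = sin (\<theta> + \<phi>)" by (simp add: cos_diff)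
      moreover have "cos (pi/2 - \<phi>) = sin \<phi>" by (simp add: cos_diff)
      moreover have "T (- \<theta>) = T \<theta>" by (simp add: T_def)
      ultimately show "?h (- \<theta>) = a * sin (\<theta> + \<phi>) * (a * sin (\<theta> + \<phi>) - b * sin \<phi>) / (T \<theta> + d)"
        by (simp only:)
    qed
    finally show ?thesis .
  qed
  also have "integral {- pi..pi} (\<lambda>\<theta>. a * cos (\<theta> + \<phi>) * (a * cos (\<theta> + \<phi>) - b * cos \<phi>) / (T \<theta> + d))
     + integral {- pi..pi} (\<lambda>\<theta>. a * sin (\<theta> + \<phi>) * (a * sin (\<theta> + \<phi>) - b * sin \<phi>) / (T \<theta> + d))
     = integral {- pi..pi} (\<lambda>\<theta>. a * cos (\<theta> + \<phi>) * (a * cos (\<theta> + \<phi>) - b * cos \<phi>) / (T \<theta> + d)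
        + a * sin (\<theta> + \<phi>) * (a * sin (\<theta> + \<phi>) - b * sin \<phi>) / (T \<theta> + d))"
    by (intro Henstock_Kurzweil_Integration.integral_add[symmetric] integrable_continuous_real continuous_intros contT ballI Tne)
  also have "(\<lambda>\<theta>. a * cos (\<theta> + \<phi>) * (a * cos (\<theta> + \<phi>) - b * cos \<phi>) / (T \<theta> + d)
        + a * sin (\<theta> + \<phi>) * (a * sin (\<theta> + \<phi>) - b * sin \<phi>) / (T \<theta> + d)) = (\<lambda>\<theta>. a * (a - b * cos \<theta>) / (T \<theta> + d))"
  proof
    fix \<theta>
    have "cos \<theta> = cos (\<theta> + \<phi>) * cos \<phi> + sin (\<theta> + \<phi>) * sin \<phi>"
      using cos_diff[of "\<theta> + \<phi>" \<phi>] by simp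
    then have "a * cos (\<theta> + \<phi>) * (a * cos (\<theta> + \<phi>) - b * cos \<phi>) + a * sin (\<theta> + \<phi>) * (a * sin (\<theta> + \<phi>) - b * sin \<phi>) = a * (a - b * cos \<theta>)"
      using sin_cos_squared_add[of "\<theta> + \<phi>"] by algebra
    then show "a * cos (\<theta> + \<phi>) * (a * cos (\<theta> + \<phi>) - b * cos \<phi>) / (T \<theta> + d)
        + a * sin (\<theta> + \<phi>) * (a * sin (\<theta> + \<phi>) - b * sin \<phi>) / (T \<theta> + d) = a * (a - b * cos \<theta>) / (T \<theta> + d)"
      by (simp only: add_divide_distrib[symmetric])
  qed
  also have "integral {- pi..pi} (\<lambda>\<theta>. a * (a - b * cos \<theta>) / (T \<theta> + d)) =
      4 * integral {0..pi/2} (\<lambda>\<alpha>. a * (a - b * (2 * (sin \<alpha>)\<^sup>2 - 1)) / (sqrt (d\<^sup>2 + (a\<^sup>2 + b\<^sup>2 - 2 * a * b * (2 * (sin \<alpha>)\<^sup>2 - 1))) + d))"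
    unfolding T_def
  proof (rule integral_cos_half_angle)
    \<comment> \<open>Every \<open>c\<close> in the interval is the cosine of
      \<open>arccos c\<close>, so the denominator is nonzero by the bound already known for
      angles.\<close>
    have "sqrt (d\<^sup>2 + (a\<^sup>2 + b\<^sup>2 - 2 * a * b * c)) + d \<noteq> 0" if "c \<in> {-1..1}" for c
      using Tne[of "arccos c"] that by (simp add: T_def cos_arccos)
    then show "continuous_on {-1..1} (\<lambda>c. a * (a - b * c) / (sqrt (d\<^sup>2 + (a\<^sup>2 + b\<^sup>2 - 2 * a * b * c)) + d))"
      by (intro continuous_intros) blast
  qed
  also have "\<dots> = 2 * pi * a * Y a b d"
    using integral_unique[OF boundary_integral_eq_Y[OF a b d]]
    unfolding law_of_cosines_half_angle add_diff_eq by simp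
  finally show ?thesis by (simp only: S_def)
qed

section \<open>Solids of revolution\<close>

lemma norm_vec3: "norm (x :: real ^ 3) = sqrt ((x $ 1)\<^sup>2 + (x $ 2)\<^sup>2 + (x $ 3)\<^sup>2)"
  by (simp add: norm_vec_def L2_set_def sum_3)

lemma measurable_vec3: "(\<lambda>(z, p). vector [fst p, snd p, z]) \<in> lborel \<Otimes>\<^sub>M lborel \<rightarrow>\<^sub>M (borel :: (real ^ 3) measure)"
proof -
  let ?t = "\<lambda>(z :: real, p :: real \<times> real). (vector [fst p, snd p, z] :: real ^ 3)"
  have "continuous_on UNIV ?t"
  proof (subst continuous_on_componentwise, intro ballI)
    fix i :: "real ^ 3" assume "i \<in> Basis"
    then obtain k where "i = axis k 1" by (auto simp: Basis_vec_def)
    then show "continuous_on UNIV (\<lambda>x. ?t x \<bullet> i)"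
      using exhaust_3[of k] by (elim disjE) (simp_all add: inner_axis case_prod_unfold, (intro continuous_intros)+)
  qed
  then show ?thesis by (simp add: lborel_prod borel_measurable_continuous_onI)
qed

text \<open>Lebesgue measure is determined by its values on boxes, and the preimage of a box under
  the coordinate map is a product of intervals. The height is the first factor, so that Tonelli's
  theorem gives an outer integral over heights of integrals over planar slices.\<close>

lemma lborel_vec3: "(lborel :: (real ^ 3) measure) = distr (lborel \<Otimes>\<^sub>M lborel) borel (\<lambda>(z, p). vector [fst p, snd p, z])"
proof -
  let ?t = "\<lambda>(z :: real, p :: real \<times> real). (vector [fst p, snd p, z] :: real ^ 3)"
  show ?thesis
  proof (rule lborel_eqI)
    fix l u :: "real ^ 3"
    assume le: "\<And>b. b \<in> Basis \<Longrightarrow> l \<bullet> b \<le> u \<bullet> b"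
    have lek: "l $ k \<le> u $ k" for k
      using le[of "axis k 1"] by (simp add: inner_axis)
    have pre: "?t -` box l u \<inter> space (lborel \<Otimes>\<^sub>M lborel) = {l $ 3<..<u $ 3} \<times> ({l $ 1<..<u $ 1} \<times> {l $ 2<..<u $ 2})"
      by (auto simp: mem_box_cart forall_3 space_pair_measure)
    have "emeasure (distr (lborel \<Otimes>\<^sub>M lborel) borel ?t) (box l u) = emeasure (lborel \<Otimes>\<^sub>M lborel) ({l $ 3<..<u $ 3} \<times> ({l $ 1<..<u $ 1} \<times> {l $ 2<..<u $ 2}))"
      by (subst emeasure_distr[OF measurable_vec3]) (simp_all only: pre, simp)
    also have "\<dots> = emeasure lborel {l $ 3<..<u $ 3} * (emeasure lborel {l $ 1<..<u $ 1} * emeasure lborel {l $ 2<..<u $ 2})"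
    proof -
      have "emeasure (lborel \<Otimes>\<^sub>M lborel) (A \<times> A') = emeasure lborel A * emeasure lborel A'" if "A \<in> sets borel" "A' \<in> sets borel"
        for A :: "real set" and A' :: "(real \<times> real) set"
        by (rule lborel.emeasure_pair_measure_Times) (use that in simp_all)
      moreover have "emeasure (lborel :: (real \<times> real) measure) (A \<times> A') = emeasure lborel A * emeasure lborel A'"
        if "A \<in> sets borel" "A' \<in> sets borel" for A A' :: "real set"
        unfolding lborel_prod[symmetric] by (rule lborel.emeasure_pair_measure_Times) (use that in simp_all)
      ultimately show ?thesis by (simp add: borel_open open_Times)
    qed
    also have "\<dots> = ennreal (\<Prod>b\<in>Basis. (u - l) \<bullet> b)"
    proof -
      have "(\<Prod>b\<in>Basis. (u - l) \<bullet> b) = (\<Prod>k\<in>UNIV. (u - l) $ k)"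
        by (simp add: Basis_vec_def UNION_singleton_eq_range prod.reindex inj_on_def axis_eq_axis inner_axis)
      also have "\<dots> = (u $ 1 - l $ 1) * (u $ 2 - l $ 2) * (u $ 3 - l $ 3)"
        unfolding UNIV_3 by (simp add: mult.assoc)
      finally have "ennreal (\<Prod>b\<in>Basis. (u - l) \<bullet> b) =
          ennreal (u $ 3 - l $ 3) * (ennreal (u $ 1 - l $ 1) * ennreal (u $ 2 - l $ 2))"
        using lek by (simp only: ennreal_mult[symmetric] diff_ge_0_iff_ge mult_nonneg_nonneg ac_simps)
      then show ?thesis using lek by (simp only: emeasure_lborel_Ioo)
    qed
    finally show "emeasure (distr (lborel \<Otimes>\<^sub>M lborel) borel ?t) (box l u) = ennreal (\<Prod>b\<in>Basis. (u - l) \<bullet> b)" .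
  qed simp
qed

section \<open>Shape of the body and distance to the rotation axis\<close>

text \<open>Polar coordinates eliminate the angle, which is chosen as 0 on the
  \<open>z\<close>-axis. Membership becomes a condition on the Cartesian coordinates, with a disk as
  the slice at each height.\<close>

lemma solid_of_revolution_eq:
  assumes "\<And>x. x \<in> {l..u} \<Longrightarrow> 0 \<le> f x"
  shows "solid_of_revolution f l u = {x. x $ 3 \<in> {l..u} \<and> (x $ 1, x $ 2) \<in> cball 0 (f (x $ 3))}"
proof (intro set_eqI iffI)
  fix x :: "real ^ 3" assume "x \<in> solid_of_revolution f l u"
  then obtain s \<phi> z where x: "x = cylindrical s \<phi> z" "l \<le> z" "z \<le> u" "0 \<le> s" "s \<le> f z"
    by (auto simp: solid_of_revolution_def)
  have "(s * cos \<phi>)\<^sup>2 + (s * sin \<phi>)\<^sup>2 = s\<^sup>2"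
    using sin_cos_squared_add[of \<phi>] by algebra
  then show "x \<in> {x. x $ 3 \<in> {l..u} \<and> (x $ 1, x $ 2) \<in> cball 0 (f (x $ 3))}"
    using x by (simp add: cylindrical_def norm_Pair)
next
  fix x :: "real ^ 3" assume x: "x \<in> {x. x $ 3 \<in> {l..u} \<and> (x $ 1, x $ 2) \<in> cball 0 (f (x $ 3))}"
  define s where "s = norm (x $ 1, x $ 2)"
  have "\<exists>\<phi>. 0 \<le> \<phi> \<and> \<phi> \<le> 2 * pi \<and> x $ 1 = s * cos \<phi> \<and> x $ 2 = s * sin \<phi>"
  proof (cases "s = 0")
    case True
    then have "x $ 1 = 0" "x $ 2 = 0" by (auto simp: s_def zero_prod_def)
    then show ?thesis using True by (intro exI[of _ 0]) simp
  next
    case False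
    have s2: "s\<^sup>2 = (x $ 1)\<^sup>2 + (x $ 2)\<^sup>2" by (simp add: s_def norm_Pair)
    have "(x $ 1 / s)\<^sup>2 + (x $ 2 / s)\<^sup>2 = 1"
      unfolding power_divide add_divide_distrib[symmetric] s2[symmetric] using False by simp
    from sincos_total_2pi[OF this] obtain \<phi> where "0 \<le> \<phi>" "\<phi> < 2 * pi" "x $ 1 / s = cos \<phi>" "x $ 2 / s = sin \<phi>"
      by blast
    then show ?thesis using False by (intro exI[of _ \<phi>]) (auto simp: field_simps)
  qed
  then obtain \<phi> where \<phi>: "0 \<le> \<phi>" "\<phi> \<le> 2 * pi" "x $ 1 = s * cos \<phi>" "x $ 2 = s * sin \<phi>"
    by blast
  have "x = cylindrical s \<phi> (x $ 3)"
    using \<phi> by (simp add: cylindrical_def vec_eq_iff forall_3)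
  moreover have "0 \<le> s" "s \<le> f (x $ 3)" using x by (simp_all add: s_def)
  ultimately show "x \<in> solid_of_revolution f l u"
    using x \<phi> unfolding solid_of_revolution_def by fastforce
qed

lemma infdist_s_axis: "(infdist (cylindrical s \<phi> z) s_axis)\<^sup>2 = s\<^sup>2 * (sin \<phi>)\<^sup>2 + z\<^sup>2"
proof -
  let ?c = "cylindrical s \<phi> z"
  have dist: "dist ?c (t *\<^sub>R cylindrical 1 0 0) = sqrt ((s * cos \<phi> - t)\<^sup>2 + ((s * sin \<phi>)\<^sup>2 + z\<^sup>2))" for t
    by (simp add: dist_norm norm_vec3 cylindrical_def add.assoc)
  have "infdist ?c s_axis = sqrt ((s * sin \<phi>)\<^sup>2 + z\<^sup>2)"
  proof (rule antisym)
    \<comment> \<open>The point with parameter \<open>s * cos \<phi>\<close> is the foot of the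
      perpendicular.\<close>
    have "infdist ?c s_axis \<le> dist ?c ((s * cos \<phi>) *\<^sub>R cylindrical 1 0 0)"
      unfolding s_axis_def by (intro infdist_le rangeI)
    then show "infdist ?c s_axis \<le> sqrt ((s * sin \<phi>)\<^sup>2 + z\<^sup>2)" by (simp add: dist)
    show "sqrt ((s * sin \<phi>)\<^sup>2 + z\<^sup>2) \<le> infdist ?c s_axis"
      unfolding infdist_def s_axis_def
      by (auto intro!: cINF_greatest simp: dist)
  qed
  then show ?thesis by (simp add: power_mult_distrib)
qed

section \<open>Measurability of the body and null sets of heights\<close>

text \<open>Dividing the integrand by \<open>c\<close> leaves the indicator of \<open>A\<close>.
  Applied to the constant density, it turns the finite mass contained in
  \<open>has_center_of_mass\<close> into Lebesgue measurability of the body.\<close>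

lemma set_integrable_const_imp_sets:
  assumes "set_integrable M A (\<lambda>_. c :: real)" "c \<noteq> 0"
  shows "A \<inter> space M \<in> sets M"
proof -
  have "(\<lambda>x. indicator A x *\<^sub>R c) \<in> borel_measurable M"
    using assms(1) by (auto simp: set_integrable_def)
  then have "(\<lambda>x. (indicator A x *\<^sub>R c) / c) \<in> borel_measurable M" by measurable
  then have "indicat_real A \<in> borel_measurable M" using assms(2) by simp
  then show ?thesis by (simp add: borel_measurable_indicator_iff Int_commute)
qed

text \<open>A null set of heights lifts to a null set in space, by Fubini. This allows the radius
  function to be altered on a null set of heights.\<close>

lemma AE_vec3_component:
  assumes "AE z in lborel. P z"
  shows "AE x :: real ^ 3 in lborel. P (x $ 3)"
proof -
  obtain N where N: "{z. \<not> P z} \<subseteq> N" "N \<in> null_sets lborel"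
    using assms by (auto simp: eventually_ae_filter)
  have [measurable]: "N \<in> sets borel" using N(2) by auto
  have "AE x :: real ^ 3 in lborel. x $ 3 \<notin> N"
    unfolding lborel_vec3
  proof (subst AE_distr_iff)
    show "(\<lambda>(z, p). vector [fst p, snd p, z]) \<in> lborel \<Otimes>\<^sub>M lborel \<rightarrow>\<^sub>M (borel :: (real ^ 3) measure)"
      by (rule measurable_vec3)
    show "{x \<in> space borel. x $ 3 \<notin> N} \<in> sets (borel :: (real ^ 3) measure)"
      by measurable
    have "AE zp in lborel \<Otimes>\<^sub>M (lborel :: (real \<times> real) measure). fst zp \<notin> N"
    proof (rule lborel_pair.AE_pair_measure)
      show "{zp \<in> space (lborel \<Otimes>\<^sub>M (lborel :: (real \<times> real) measure)). fst zp \<notin> N} \<in> sets (lborel \<Otimes>\<^sub>M lborel)"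
        by measurable
      show "AE z in lborel. AE p in (lborel :: (real \<times> real) measure). fst (z, p) \<notin> N"
        using AE_not_in[OF N(2)] by eventually_elim simp
    qed
    then show "AE zp in lborel \<Otimes>\<^sub>M lborel. ((\<lambda>(z, p). vector [fst p, snd p, z]) zp :: real ^ 3) $ 3 \<notin> N"
      by (simp add: case_prod_unfold)
  qed
  then show ?thesis by eventually_elim (use N(1) in auto)
qed

section \<open>The energy of the body as an integral over its slices\<close>

theorem corollary3:
  fixes G \<rho> \<omega> z0 z1 z \<phi> :: real
    and f :: "real \<Rightarrow> real"
  assumes "G > 0" and "\<rho> > 0" and "- z0 < z1"
    and "f \<in> borel_measurable (lebesgue_on {- z0..z1})"
    and "\<And>x. x \<in> {- z0..z1} \<Longrightarrow> 0 \<le> f x"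
    and "has_center_of_mass \<rho> (solid_of_revolution f (- z0) z1) 0"
    and "z \<in> {- z0..z1}" and "\<phi> \<in> {0..2 * pi}"
  shows "total_energy G \<rho> \<omega> (solid_of_revolution f (- z0) z1) s_axis (cylindrical (f z) \<phi> z)
       = - 2 * pi * G * \<rho> * (LINT z':{- z0..z1}|lebesgue. f z' * Y (f z') (f z) \<bar>z - z'\<bar>)
         - 1 / 2 * \<omega>\<^sup>2 * ((f z)\<^sup>2 * (sin \<phi>)\<^sup>2 + z\<^sup>2)"
proof -
  define I where "I = {- z0..z1}"
  define B where "B = solid_of_revolution f (- z0) z1"
  define r where "r = cylindrical (f z) \<phi> z"
  define b where "b = f z"
  have b: "b \<ge> 0" using assms(5,7) by (simp add: b_def)
  have f_nonneg: "0 \<le> f x" if "x \<in> I" for x using assms(5) that by (simp add: I_def)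
  have B_sets: "B \<in> sets lebesgue"
    using set_integrable_const_imp_sets[of lebesgue B \<rho>] assms(2,6)
    by (simp add: has_center_of_mass_def B_def)
  have B_eq: "B = {x. x $ 3 \<in> I \<and> (x $ 1, x $ 2) \<in> cball 0 (f (x $ 3))}"
    unfolding B_def I_def by (rule solid_of_revolution_eq) (rule assms(5))
  have "(\<lambda>x. indicator I x * f x) \<in> borel_measurable lebesgue"
    using assms(4) by (subst (asm) borel_measurable_restrict_space_iff) (auto simp: I_def)
  \<comment> \<open>The radius \<open>f\<close> is only Lebesgue measurable, whereas Tonelli's
    theorem is applied to a product of Borel measures. Hence \<open>f\<close> is replaced by a Borel
    function \<open>g\<close> that agrees with it at almost every height of
    \<open>I\<close>.\<close>
  from completion_ex_borel_measurable_real[OF this]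
  obtain g where g[measurable]: "g \<in> borel_measurable lborel" and fg: "AE x in lborel. indicator I x * f x = g x"
    by auto
  have g'[measurable]: "g \<in> borel_measurable borel" using g by simp
  \<comment> \<open>\<open>w\<close> is the inverse distance from the surface point to the point
    \<open>p\<close> of the slice at height \<open>z'\<close>, \<open>D\<close> restricts it to the
    body with radius \<open>g\<close>, and \<open>H\<close> is the resulting integral over one
    slice.\<close>
  define w where "w z' p = 1 / sqrt ((z - z')\<^sup>2 + (fst p - b * cos \<phi>)\<^sup>2 + (snd p - b * sin \<phi>)\<^sup>2)" for z' and p :: "real \<times> real"
  define D where "D = (\<lambda>z' p. indicator I z' * indicator (cball 0 (g z')) p * ennreal (w z' p))"
  define H where "H z' = (\<integral>\<^sup>+p. D z' p \<partial>lborel)" for z'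
  have D_borel: "case_prod D \<in> borel_measurable borel"
  proof -
    have [measurable]: "(fst :: real \<times> (real \<times> real) \<Rightarrow> _) \<in> borel_measurable borel" "(snd :: real \<times> (real \<times> real) \<Rightarrow> _) \<in> borel_measurable borel"
      by (intro borel_measurable_continuous_onI continuous_intros)+
    have "(\<lambda>x. (z - fst x)\<^sup>2 + (fst (snd x) - b * cos \<phi>)\<^sup>2 + (snd (snd x) - b * sin \<phi>)\<^sup>2) \<in> borel_measurable (borel :: (real \<times> (real \<times> real)) measure)"
      by (intro borel_measurable_continuous_onI continuous_intros)
    then have [measurable]: "(\<lambda>x. w (fst x) (snd x)) \<in> borel_measurable borel"
      unfolding w_def by measurable
    have [measurable]: "(\<lambda>x. g (fst x)) \<in> borel_measurable (borel :: (real \<times> (real \<times> real)) measure)"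
      by measurable
    have [measurable]: "Measurable.pred (borel :: (real \<times> (real \<times> real)) measure) (\<lambda>x. snd x \<in> cball 0 (g (fst x)))"
      unfolding mem_cball_0 by measurable
    have [measurable]: "Measurable.pred (borel :: (real \<times> (real \<times> real)) measure) (\<lambda>x. fst x \<in> I)"
      unfolding I_def by measurable
    show ?thesis
      unfolding D_def case_prod_unfold indicator_def by measurable
  qed
  then have D_meas: "case_prod D \<in> borel_measurable (lborel \<Otimes>\<^sub>M lborel)"
    by (simp add: lborel_prod)
  have H_meas[measurable]: "H \<in> borel_measurable borel"
    using lborel.borel_measurable_nn_integral_fst[OF D_meas] by (simp add: H_def[abs_def])

  have wr: "1 / norm (r - vector [fst p, snd p, z']) = w z' p" for z' p
    by (simp add: norm_vec3 r_def cylindrical_def w_def b_def power2_commute add_ac)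

  have nnB: "(\<integral>\<^sup>+x. indicator B x * ennreal (1 / norm (r - x)) \<partial>lborel) = (\<integral>\<^sup>+z'. H z' \<partial>lborel)"
  proof -
    let ?Dx = "\<lambda>x :: real ^ 3. D (x $ 3) (x $ 1, x $ 2)"
    have Dx: "?Dx \<in> borel_measurable borel"
    proof -
      have "(\<lambda>x :: real ^ 3. (x $ 3, (x $ 1, x $ 2))) \<in> borel_measurable borel"
        by (intro borel_measurable_continuous_onI continuous_intros)
      from measurable_compose[OF this D_borel] show ?thesis by simp
    qed
    have "AE x in lborel. indicator B x * ennreal (1 / norm (r - x)) = ?Dx x"
      using AE_vec3_component[OF fg]
    proof eventually_elim
      case (elim x)
      have "x = vector [x $ 1, x $ 2, x $ 3]" by (simp add: vec_eq_iff forall_3)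
      then have "1 / norm (r - x) = w (x $ 3) (x $ 1, x $ 2)"
        using wr[of "(x $ 1, x $ 2)" "x $ 3"] by simp
      then show ?case
        using elim by (auto simp: D_def B_eq split: split_indicator)
    qed
    then have "(\<integral>\<^sup>+x. indicator B x * ennreal (1 / norm (r - x)) \<partial>lborel) = (\<integral>\<^sup>+x. ?Dx x \<partial>lborel)"
      by (rule nn_integral_cong_AE)
    also have "\<dots> = (\<integral>\<^sup>+zp. case_prod D zp \<partial>(lborel \<Otimes>\<^sub>M lborel))"
    proof -
      let ?T = "\<lambda>(z, p). vector [fst p, snd p, z] :: real ^ 3"
      have "?Dx \<in> borel_measurable (distr (lborel \<Otimes>\<^sub>M lborel) borel ?T)"
        using Dx by simp
      from nn_integral_distr[OF measurable_vec3 this]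
      have "(\<integral>\<^sup>+x. ?Dx x \<partial>lborel) = (\<integral>\<^sup>+zp. ?Dx (?T zp) \<partial>(lborel \<Otimes>\<^sub>M lborel))"
        unfolding lborel_vec3[symmetric] .
      also have "(\<lambda>zp. ?Dx (?T zp)) = case_prod D"
        by (rule ext) (simp add: case_prod_unfold)
      finally show ?thesis .
    qed
    also have "\<dots> = (\<integral>\<^sup>+z'. H z' \<partial>lborel)"
      unfolding H_def using lborel.nn_integral_fst[OF D_meas] by simp
    finally show ?thesis .
  qed

  \<comment> \<open>The height \<open>z' = z\<close> is left out because the disk formula requires a
    positive vertical distance. Nonnegativity is recorded as well, since \<open>ennreal\<close>
    sends negative numbers to 0 and the equation alone would not determine the real value.\<close>
  have H_eq: "AE z' in lborel. H z' = ennreal (2 * pi * (indicator I z' * (f z' * Y (f z') b \<bar>z - z'\<bar>))) \<and> 0 \<le> indicator I z' * (f z' * Y (f z') b \<bar>z - z'\<bar>)"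
    using fg AE_lborel_singleton[of z]
  proof eventually_elim
    case (elim z')
    consider "z' \<notin> I" | "z' \<in> I" "f z' = 0" | "z' \<in> I" "f z' > 0" using f_nonneg[of z'] by fastforce
    then show ?case
    proof cases
      case 1
      then show ?thesis by (simp add: H_def D_def)
    next
      \<comment> \<open>A disk of radius 0 is a single point and has measure 0. On the other side
        the factor \<open>f z' = 0\<close> makes the product with \<open>Y\<close> vanish, in
        accordance with the convention for \<open>a = 0\<close>.\<close>
      case 2
      have "H z' = (\<integral>\<^sup>+p. 0 \<partial>(lborel :: (real \<times> real) measure))"
        unfolding H_def
      proof (rule nn_integral_cong_AE)
        show "AE p in lborel. D z' p = 0"
          using AE_lborel_singleton[of "0 :: real \<times> real"]
          by eventually_elim (use 2 elim in \<open>auto simp: D_def\<close>)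
      qed
      then show ?thesis using 2 by simp
    next
      case 3
      define d where "d = \<bar>z - z'\<bar>"
      have d: "d > 0" using elim by (simp add: d_def)
      have gz: "g z' = f z'" using elim 3 by simp
      have w_eq: "w z' p = 1 / sqrt (d\<^sup>2 + (fst p - b * cos \<phi>)\<^sup>2 + (snd p - b * sin \<phi>)\<^sup>2)" for p
        by (simp add: w_def d_def)
      have pos: "d\<^sup>2 + (fst p - b * cos \<phi>)\<^sup>2 + (snd p - b * sin \<phi>)\<^sup>2 > 0" for p :: "real \<times> real"
        using d by (intro add_pos_nonneg) auto
      have w_nonneg: "0 \<le> w z' p" for p using pos[of p] by (simp add: w_eq)
      have contw: "continuous_on A (w z')" for A
        unfolding w_eq using pos by (intro continuous_intros ballI) (metis less_irrefl real_sqrt_eq_0_iff)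
      have int: "integrable lborel (\<lambda>p. indicator (cball 0 (f z')) p *\<^sub>R w z' p)"
        by (rule borel_integrable_compact) (auto intro: contw)
      have val: "(LBINT p:cball 0 (f z'). w z' p) = 2 * pi * f z' * Y (f z') b d"
        unfolding w_eq by (rule LBINT_disk_inverse_distance[OF 3(2) b d])
      have "H z' = (\<integral>\<^sup>+p. ennreal (indicator (cball 0 (f z')) p *\<^sub>R w z' p) \<partial>lborel)"
        unfolding H_def using 3 by (intro nn_integral_cong) (auto simp: D_def gz split: split_indicator)
      also have "\<dots> = ennreal (LBINT p:cball 0 (f z'). w z' p)"
        unfolding set_lebesgue_integral_def
        by (rule nn_integral_eq_integral[OF int]) (auto simp: w_nonneg)
      finally have "H z' = ennreal (2 * pi * f z' * Y (f z') b d)" unfolding val .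
      moreover have "0 \<le> 2 * pi * f z' * Y (f z') b d"
        unfolding val[symmetric] set_lebesgue_integral_def
        by (rule Bochner_Integration.integral_nonneg) (auto simp: w_nonneg)
      moreover from this have "0 \<le> 2 * pi * (f z' * Y (f z') b d)" by (simp only: mult.assoc)
      then have "0 \<le> f z' * Y (f z') b d" using pi_gt_zero by (metis zero_le_mult_iff mult_pos_pos zero_less_numeral not_less)
      ultimately show ?thesis using 3 by (simp add: d_def mult.assoc)
    qed
  qed

  \<comment> \<open>Here and in \<open>lhs\<close> both integrals are tied to the same nonnegative
    integral of \<open>H\<close>. A divergent integral would have the value 0, and so would
    \<open>enn2real\<close> of infinity, so the two sides correspond in every case.\<close>
  have rhs: "(LINT z':I|lebesgue. f z' * Y (f z') b \<bar>z - z'\<bar>) = enn2real (\<integral>\<^sup>+z'. H z' \<partial>lborel) / (2 * pi)"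
  proof -
    let ?F = "\<lambda>z'. indicator I z' * (f z' * Y (f z') b \<bar>z - z'\<bar>)"
    let ?h = "\<lambda>z'. enn2real (H z') / (2 * pi)"
    have FH: "AE z' in lborel. ?h z' = ?F z'"
      using H_eq by eventually_elim (auto simp: enn2real_ennreal)
    have h_meas: "?h \<in> borel_measurable lborel" by measurable
    have "(LINT z':I|lebesgue. f z' * Y (f z') b \<bar>z - z'\<bar>) = integral\<^sup>L lebesgue ?F"
      by (simp add: set_lebesgue_integral_def)
    also have "\<dots> = integral\<^sup>L lebesgue ?h"
    proof (rule integral_cong_AE)
      show hl: "?h \<in> borel_measurable lebesgue" using h_meas by (rule measurable_completion)
      \<comment> \<open>\<open>?F\<close> contains elliptic integrals with varying parameters. Its
        measurability is inherited from the Borel function \<open>?h\<close>, which equals it almost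
        everywhere, by completeness of Lebesgue measure.\<close>
      show "?F \<in> borel_measurable lebesgue"
        by (rule borel_measurable_AE[OF hl AE_completion[OF FH]])
      show "AE z' in lebesgue. ?F z' = ?h z'"
        using AE_completion[OF FH] by eventually_elim simp
    qed
    also have "\<dots> = integral\<^sup>L lborel ?h" by (rule integral_completion[OF h_meas])
    also have "\<dots> = integral\<^sup>L lborel (\<lambda>z'. enn2real (H z')) / (2 * pi)" by simp
    also have "integral\<^sup>L lborel (\<lambda>z'. enn2real (H z')) = enn2real (\<integral>\<^sup>+z'. H z' \<partial>lborel)"
      by (rule enn2real_nn_integral_eq_integral[symmetric])
        (use H_eq in \<open>auto elim!: eventually_mono\<close>)
    finally show ?thesis .
  qed

  have lhs: "(LINT x:B|lebesgue. \<rho> / norm (r - x)) = \<rho> * enn2real (\<integral>\<^sup>+z'. H z' \<partial>lborel)"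
  proof -
    have "(LINT x:B|lebesgue. \<rho> / norm (r - x)) = (LINT x|lebesgue. \<rho> * (indicator B x * (1 / norm (r - x))))"
      by (simp add: set_lebesgue_integral_def mult_ac)
    also have "\<dots> = \<rho> * (LINT x|lebesgue. indicator B x * (1 / norm (r - x)))"
      by (rule integral_mult_right_zero)
    also have "(LINT x|lebesgue. indicator B x * (1 / norm (r - x))) = enn2real (\<integral>\<^sup>+x. ennreal (indicator B x * (1 / norm (r - x))) \<partial>lebesgue)"
    proof (rule integral_eq_nn_integral)
      have "(\<lambda>x. 1 / norm (r - x)) \<in> borel_measurable lborel" by measurable
      from measurable_completion[OF this]
      show "(\<lambda>x. indicator B x * (1 / norm (r - x))) \<in> borel_measurable lebesgue"
        by (intro borel_measurable_times borel_measurable_indicator B_sets)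
    qed simp
    also have "(\<integral>\<^sup>+x. ennreal (indicator B x * (1 / norm (r - x))) \<partial>lebesgue) = (\<integral>\<^sup>+x. indicator B x * ennreal (1 / norm (r - x)) \<partial>lborel)"
      unfolding nn_integral_completion by (intro nn_integral_cong) (auto split: split_indicator)
    finally show ?thesis unfolding nnB .
  qed

  have "total_energy G \<rho> \<omega> B s_axis r = - G * (\<rho> * enn2real (\<integral>\<^sup>+z'. H z' \<partial>lborel)) - 1 / 2 * \<omega>\<^sup>2 * ((f z)\<^sup>2 * (sin \<phi>)\<^sup>2 + z\<^sup>2)"
    unfolding total_energy_def grav_potential_def rot_energy_def lhs
    by (simp add: r_def infdist_s_axis)
  also have "\<dots> = - 2 * pi * G * \<rho> * (LINT z':I|lebesgue. f z' * Y (f z') b \<bar>z - z'\<bar>) - 1 / 2 * \<omega>\<^sup>2 * ((f z)\<^sup>2 * (sin \<phi>)\<^sup>2 + z\<^sup>2)"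
    unfolding rhs by simp
  finally show ?thesis by (simp only: B_def r_def b_def I_def)
qed

end
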